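(* Let $\mathbb{K}$ be a field of characteristic zero, let $n\ge2$, and let $\phi\in\mathrm{SA}_n(\mathbb{K})$ be four-triangular (i.e. $m$-triangular with $m=4$). If $\phi\neq\mathrm{id}$, then $\langle\phi\rangle^S=\mathrm{SLIN}_n(\mathbb{K})$, and in particular $\phi$ is normally co-tame.
   Context: $\mathrm{GA}_n(\mathbb{K})$ is the group of polynomial automorphisms of $\mathbb{A}^n$ over $\mathbb{K}$, whose elements are written $\phi=(H_1,\dots,H_n)$ with $H_i\in\mathbb{K}[x_1,\dots,x_n]$ and composed as polynomial maps. $\mathrm{SA}_n(\mathbb{K})$ is the subgroup of automorphisms with Jacobian determinant $1$. $\mathrm{Aff}_n(\mathbb{K})$ is the group of automorphisms of degree one. $\mathrm{BA}_n(\mathbb{K})$ is the group of triangular automorphisms $(a_1x_1+P_1,a_2x_2+P_2(x_1),\dots,a_nx_n+P_n(x_1,\dots,x_{n-1}))$ with $a_i\in\mathbb{K}^*$, $P_i\in\mathbb{K}[x_1,\dots,x_{i-1}]$. An automorphism $\phi$ is $m$-triangular if $\phi=\alpha_0\tau_1\alpha_1\cdots\tau_m\alpha_m$ for some $\tau_i\in\mathrm{BA}_n(\mathbb{K})$ and $\alpha_i\in\mathrm{Aff}_n(\mathbb{K})$. For $H\subseteq\mathrm{SA}_n(\mathbb{K})$, $\langle H\rangle^S$ is the normal subgroup of $\mathrm{SA}_n(\mathbb{K})$ generated by $H$. $\mathrm{SLIN}_n(\mathbb{K})=\langle \mathrm{SL}_n(\mathbb{K})\rangle^S$, where $\mathrm{SL}_n(\mathbb{K})$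 is viewed as the group of linear automorphisms of determinant $1$. An element $\theta\in\mathrm{SA}_n(\mathbb{K})$ is normally co-tame if $\langle\theta\rangle^S\supseteq\mathrm{SLIN}_n(\mathbb{K})$. *)

theory Defs
  imports
    "HOL-Analysis.Determinants"
    "HOL-Algebra.Coset"
    "HOL-Library.Poly_Mapping"
begin

text \<open>
  The variables are indexed by a finite type, so that the number of variables is the cardinality
  of that type; \<open>mpoly\<close> is the monoid algebra of the exponent vectors.
  The ring structure is the convolution product of \<^theory>\<open>HOL-Library.Poly_Mapping\<close>.
\<close>

type_synonym ('n, 'k) mpoly = "('n \<Rightarrow>\<^sub>0 nat) \<Rightarrow>\<^sub>0 'k"

definition mconst :: "'k::zero \<Rightarrow> ('n, 'k) mpoly" where
  "mconst c = Poly_Mapping.single 0 c"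

definition mvar :: "'n \<Rightarrow> ('n, 'k::zero_neq_one) mpoly" where
  "mvar i = Poly_Mapping.single (Poly_Mapping.single i 1) 1"

definition mpoly_subst :: "('n::finite \<Rightarrow> ('n, 'k) mpoly) \<Rightarrow> ('n, 'k::comm_ring_1) mpoly \<Rightarrow> ('n, 'k) mpoly"
  where "mpoly_subst \<sigma> p =
    (\<Sum>m\<in>Poly_Mapping.keys p. mconst (Poly_Mapping.lookup p m) * (\<Prod>i\<in>UNIV. \<sigma> i ^ Poly_Mapping.lookup m i))"

text \<open>
  The exponent subtraction below is truncated; when it truncates, the coefficient vanishes.
\<close>

definition mpoly_deriv :: "'n \<Rightarrow> ('n, 'k::comm_ring_1) mpoly \<Rightarrow> ('n, 'k) mpoly" where
  "mpoly_deriv j p = (\<Sum>m\<in>Poly_Mapping.keys p.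
     Poly_Mapping.single (m - Poly_Mapping.single j 1)
       (of_nat (Poly_Mapping.lookup m j) * Poly_Mapping.lookup p m))"

definition mpoly_vars :: "('n, 'k::zero) mpoly \<Rightarrow> 'n set" where
  "mpoly_vars p = (\<Union>m\<in>Poly_Mapping.keys p. Poly_Mapping.keys m)"

text \<open>Here the zero polynomial has degree \<open>0\<close>.\<close>

definition mpoly_degree :: "('n::finite, 'k::zero) mpoly \<Rightarrow> nat" where
  "mpoly_degree p =
    Max (insert 0 ((\<lambda>m. \<Sum>i\<in>UNIV. Poly_Mapping.lookup m i) ` Poly_Mapping.keys p))"

text \<open>A tuple \<open>(H\<^sub>1, \<dots>, H\<^sub>n)\<close> is a function from variable indices to polynomials.\<close>

type_synonym ('n, 'k) poly_map = "'n \<Rightarrow> ('n, 'k) mpoly"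

definition poly_map_comp ::
    "('n::finite, 'k::comm_ring_1) poly_map \<Rightarrow> ('n, 'k) poly_map \<Rightarrow> ('n, 'k) poly_map" where
  "poly_map_comp \<phi> \<psi> = (\<lambda>i. mpoly_subst \<psi> (\<phi> i))"

definition poly_End :: "('n::finite, 'k::field) poly_map monoid" where
  "poly_End = \<lparr>carrier = UNIV, mult = poly_map_comp, one = mvar\<rparr>"

definition GA :: "('n::finite, 'k::field) poly_map monoid" where
  "GA = units_of poly_End"

definition jacobian :: "('n::finite, 'k::comm_ring_1) poly_map \<Rightarrow> ('n, 'k) mpoly ^ 'n ^ 'n" where
  "jacobian \<phi> = (\<chi> i j. mpoly_deriv j (\<phi> i))"

definition SA :: "('n::finite, 'k::field) poly_map monoid" where
  "SA = GA\<lparr>carrier := {\<phi> \<in> carrier GA. det (jacobian \<phi>) = 1}\<rparr>"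

definition Aff :: "('n::finite, 'k::field) poly_map set" where
  "Aff = {\<alpha> \<in> carrier GA. Max (range (\<lambda>i. mpoly_degree (\<alpha> i))) = 1}"

text \<open>
  The linear order on the finite index type plays the role of the numbering \<open>1, \<dots>, n\<close> of the
  variables.
\<close>

definition BA :: "('n::{finite, linorder}, 'k::field) poly_map set" where
  "BA = {\<tau> \<in> carrier GA. \<exists>a P. \<forall>i. a i \<noteq> 0 \<and> mpoly_vars (P i) \<subseteq> {..<i} \<and>
     \<tau> i = mconst (a i) * mvar i + P i}"

inductive m_triangular :: "nat \<Rightarrow> ('n::{finite, linorder}, 'k::field) poly_map \<Rightarrow> bool" where
  "\<alpha> \<in> Aff \<Longrightarrow> m_triangular 0 \<alpha>"
| "m_triangular m \<phi> \<Longrightarrow> \<tau> \<in> BA \<Longrightarrow> \<alpha> \<in> Aff \<Longrightarrow>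
     m_triangular (Suc m) (\<phi> \<otimes>\<^bsub>GA\<^esub> \<tau> \<otimes>\<^bsub>GA\<^esub> \<alpha>)"

definition linear_poly_map :: "'k::comm_ring_1 ^ 'n ^ 'n \<Rightarrow> ('n::finite, 'k) poly_map" where
  "linear_poly_map A = (\<lambda>i. \<Sum>j\<in>UNIV. mconst (A $ i $ j) * mvar j)"

definition SL :: "('n::finite, 'k::field) poly_map set" where
  "SL = {linear_poly_map A |A. det A = 1}"

text \<open>
  The family of normal subgroups containing \<open>H\<close> is nonempty when \<open>G\<close> is a group and
  \<open>H \<subseteq> carrier G\<close>; see \<open>normal_closure_normal\<close>, \<open>group_SA\<close> and \<open>SL_subset_SA\<close> below.
\<close>

definition normal_closure :: "('a, 'b) monoid_scheme \<Rightarrow> 'a set \<Rightarrow> 'a set" where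
  "normal_closure G H = \<Inter> {N. N \<lhd> G \<and> H \<subseteq> N}"

definition SLIN :: "('n::finite, 'k::field) poly_map set" where
  "SLIN = normal_closure SA SL"

definition normally_co_tame :: "('n::finite, 'k::field) poly_map \<Rightarrow> bool" where
  "normally_co_tame \<theta> \<longleftrightarrow> \<theta> \<in> carrier SA \<and> SLIN \<subseteq> normal_closure SA {\<theta>}"

lemma mpoly_sum_monomials:
  "p = (\<Sum>m\<in>Poly_Mapping.keys p. Poly_Mapping.single m (Poly_Mapping.lookup p m))"
  by (rule poly_mapping_eqI)
    (simp add: lookup_sum lookup_single when_def in_keys_iff)

lemma mpoly_subst_superset:
  assumes "finite S" "Poly_Mapping.keys p \<subseteq> S"
  shows "mpoly_subst \<sigma> p =
    (\<Sum>m\<in>S. mconst (Poly_Mapping.lookup p m) * (\<Prod>i\<in>UNIV. \<sigma> i ^ Poly_Mapping.lookup m i))"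
  unfolding mpoly_subst_def
  by (rule sum.mono_neutral_left) (use assms in \<open>auto simp: in_keys_iff mconst_def\<close>)

lemma mpoly_deriv_superset:
  assumes "finite S" "Poly_Mapping.keys p \<subseteq> S"
  shows "mpoly_deriv j p = (\<Sum>m\<in>S. Poly_Mapping.single (m - Poly_Mapping.single j 1)
       (of_nat (Poly_Mapping.lookup m j) * Poly_Mapping.lookup p m))"
  unfolding mpoly_deriv_def
  by (rule sum.mono_neutral_left) (use assms in \<open>auto simp: in_keys_iff\<close>)

lemma mpoly_subst_add: "mpoly_subst \<sigma> (p + q) = mpoly_subst \<sigma> p + mpoly_subst \<sigma> q"
proof -
  let ?S = "Poly_Mapping.keys p \<union> Poly_Mapping.keys q"
  have "Poly_Mapping.keys (p + q) \<subseteq> ?S" by (rule Poly_Mapping.keys_add)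
  then show ?thesis
    by (subst (1 2 3) mpoly_subst_superset[where S = ?S])
      (auto simp: lookup_add mconst_def single_add distrib_right sum.distrib)
qed

lemma mpoly_deriv_add: "mpoly_deriv j (p + q) = mpoly_deriv j p + mpoly_deriv j q"
proof -
  let ?S = "Poly_Mapping.keys p \<union> Poly_Mapping.keys q"
  have "Poly_Mapping.keys (p + q) \<subseteq> ?S" by (rule Poly_Mapping.keys_add)
  then show ?thesis
    by (subst (1 2 3) mpoly_deriv_superset[where S = ?S])
      (auto simp: lookup_add single_add distrib_left sum.distrib)
qed

lemma mpoly_subst_0 [simp]: "mpoly_subst \<sigma> 0 = 0"
  by (simp add: mpoly_subst_def)

lemma mpoly_deriv_0 [simp]: "mpoly_deriv j 0 = 0"
  by (simp add: mpoly_deriv_def)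

lemma mpoly_subst_sum: "mpoly_subst \<sigma> (sum f A) = (\<Sum>a\<in>A. mpoly_subst \<sigma> (f a))"
  by (induction A rule: infinite_finite_induct) (simp_all add: mpoly_subst_add)

lemma mpoly_deriv_sum: "mpoly_deriv j (sum f A) = (\<Sum>a\<in>A. mpoly_deriv j (f a))"
  by (induction A rule: infinite_finite_induct) (simp_all add: mpoly_deriv_add)

lemma mpoly_subst_single:
  "mpoly_subst \<sigma> (Poly_Mapping.single m c) = mconst c * (\<Prod>i\<in>UNIV. \<sigma> i ^ Poly_Mapping.lookup m i)"
  by (subst mpoly_subst_superset[where S = "{m}"]) (auto split: if_splits)

lemma mpoly_deriv_single:
  "mpoly_deriv j (Poly_Mapping.single m c) =
    Poly_Mapping.single (m - Poly_Mapping.single j 1) (of_nat (Poly_Mapping.lookup m j) * c)"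
  by (subst mpoly_deriv_superset[where S = "{m}"]) (auto split: if_splits)

lemma mpoly_mult_monomials:
  "p * q = (\<Sum>m\<in>Poly_Mapping.keys p. \<Sum>m'\<in>Poly_Mapping.keys q.
     Poly_Mapping.single m (Poly_Mapping.lookup p m) * Poly_Mapping.single m' (Poly_Mapping.lookup q m'))"
  by (subst mpoly_sum_monomials[of p], subst mpoly_sum_monomials[of q]) (simp add: sum_product)

lemma mconst_mult: "mconst (a * b) = mconst a * mconst b"
  by (simp add: mconst_def mult_single)

lemma mpoly_subst_mult: "mpoly_subst \<sigma> (p * q) = mpoly_subst \<sigma> p * mpoly_subst \<sigma> q"
proof -
  have *: "mpoly_subst \<sigma> (Poly_Mapping.single m a * Poly_Mapping.single m' b) =
      mpoly_subst \<sigma> (Poly_Mapping.single m a) * mpoly_subst \<sigma> (Poly_Mapping.single m' b)" for m m' a b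
    by (simp add: mult_single mpoly_subst_single mconst_mult lookup_add power_add prod.distrib ac_simps)
  have "mpoly_subst \<sigma> (p * q) =
    mpoly_subst \<sigma> (\<Sum>m\<in>Poly_Mapping.keys p. Poly_Mapping.single m (Poly_Mapping.lookup p m)) *
    mpoly_subst \<sigma> (\<Sum>m\<in>Poly_Mapping.keys q. Poly_Mapping.single m (Poly_Mapping.lookup q m))"
    by (simp add: mpoly_mult_monomials[of p q] mpoly_subst_sum * sum_product)
  then show ?thesis by (simp flip: mpoly_sum_monomials)
qed

lemma mpoly_deriv_mult_single:
  fixes a b :: "'k::comm_ring_1" and m m' :: "'n \<Rightarrow>\<^sub>0 nat"
  shows "mpoly_deriv j (Poly_Mapping.single m a * Poly_Mapping.single m' b) =
    mpoly_deriv j (Poly_Mapping.single m a) * Poly_Mapping.single m' b +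
    Poly_Mapping.single m a * mpoly_deriv j (Poly_Mapping.single m' b)"
proof -
  let ?e = "Poly_Mapping.single j (1::nat)"
  have 1: "m - ?e + m' = m + m' - ?e" if "Poly_Mapping.lookup m j \<noteq> 0" for m m' :: "'n \<Rightarrow>\<^sub>0 nat"
    by (rule poly_mapping_eqI) (use that in \<open>auto simp: lookup_add lookup_minus lookup_single when_def\<close>)
  have 2: "Poly_Mapping.single (m - ?e + m') (of_nat (Poly_Mapping.lookup m j) * c) =
     Poly_Mapping.single (m + m' - ?e) (of_nat (Poly_Mapping.lookup m j) * c)"
    for m m' :: "'n \<Rightarrow>\<^sub>0 nat" and c :: 'k
  proof (cases "Poly_Mapping.lookup m j = 0")
    case False
    then show ?thesis by (simp only: 1[OF False])
  qed simp
  have 3: "Poly_Mapping.single (m + (m' - ?e)) (of_nat (Poly_Mapping.lookup m' j) * c) =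
     Poly_Mapping.single (m + m' - ?e) (of_nat (Poly_Mapping.lookup m' j) * c)" for c :: 'k
    using 2[of m' m c] by (simp only: add.commute)
  show ?thesis
    by (simp add: mult_single mpoly_deriv_single mult.assoc lookup_add distrib_right single_add
      mult.left_commute[of a] 2[simplified] 3[simplified])
qed

lemma mpoly_deriv_mult: "mpoly_deriv j (p * q) = mpoly_deriv j p * q + p * mpoly_deriv j q"
proof -
  let ?P = "\<Sum>m\<in>Poly_Mapping.keys p. Poly_Mapping.single m (Poly_Mapping.lookup p m)"
  let ?Q = "\<Sum>m\<in>Poly_Mapping.keys q. Poly_Mapping.single m (Poly_Mapping.lookup q m)"
  have "mpoly_deriv j (?P * ?Q) = mpoly_deriv j ?P * ?Q + ?P * mpoly_deriv j ?Q"
    unfolding sum_product mpoly_deriv_sum mpoly_deriv_mult_single sum.distrib ..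
  then show ?thesis by (simp flip: mpoly_sum_monomials)
qed

lemma mpoly_subst_mconst [simp]: "mpoly_subst \<sigma> (mconst c) = mconst c"
  by (simp add: mconst_def mpoly_subst_single)

lemma mpoly_deriv_mconst [simp]: "mpoly_deriv j (mconst c) = 0"
  by (simp add: mconst_def mpoly_deriv_single)

lemma mpoly_subst_mvar [simp]: "mpoly_subst \<sigma> (mvar i) = \<sigma> i"
proof -
  have "mpoly_subst \<sigma> (mvar i) = (\<Prod>j\<in>UNIV. \<sigma> j ^ Poly_Mapping.lookup (Poly_Mapping.single i 1) j)"
    by (simp add: mvar_def mpoly_subst_single mconst_def)
  also have "\<dots> = (\<Prod>j\<in>UNIV. if j = i then \<sigma> i else 1)"
    by (rule prod.cong) (auto simp: lookup_single when_def)
  finally have "mpoly_subst \<sigma> (mvar i) = (\<Prod>j\<in>UNIV. if j = i then \<sigma> i else 1)" .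
  then show ?thesis by simp
qed

lemma mpoly_deriv_mvar: "mpoly_deriv j (mvar i) = (if i = j then 1 else 0)"
  by (auto simp: mvar_def mpoly_deriv_single lookup_single)

lemma mconst_1 [simp]: "mconst 1 = 1"
  by (simp add: mconst_def)

lemma mpoly_subst_1 [simp]: "mpoly_subst \<sigma> 1 = 1"
  using mpoly_subst_mconst[of \<sigma> 1] by simp

lemma single_power_mvar: "mvar i ^ k = Poly_Mapping.single (Poly_Mapping.single i k) 1"
  by (induction k) (simp_all add: mvar_def mult_single flip: single_add)

lemma monomial_eq:
  fixes m :: "'n::finite \<Rightarrow>\<^sub>0 nat" and c :: "'k::comm_ring_1"
  shows "Poly_Mapping.single m c = mconst c * (\<Prod>i\<in>UNIV. mvar i ^ Poly_Mapping.lookup m i)"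
proof -
  have "(\<Prod>i\<in>A. mvar i ^ Poly_Mapping.lookup m i) =
    Poly_Mapping.single (\<Sum>i\<in>A. Poly_Mapping.single i (Poly_Mapping.lookup m i)) (1::'k)" if "finite A" for A
    using that by (induction A) (simp_all add: single_power_mvar mult_single)
  moreover have "(\<Sum>i\<in>UNIV. Poly_Mapping.single i (Poly_Mapping.lookup m i)) = m"
    by (rule poly_mapping_eqI) (simp add: lookup_sum lookup_single when_def)
  ultimately show ?thesis by (simp add: mconst_def mult_single)
qed

lemma mpoly_induct [case_names const var add mult]:
  fixes p :: "('n::finite, 'k::comm_ring_1) mpoly"
  assumes const: "\<And>c. P (mconst c)" and var: "\<And>i. P (mvar i)"
    and add: "\<And>p q. P p \<Longrightarrow> P q \<Longrightarrow> P (p + q)" and mult: "\<And>p q. P p \<Longrightarrow> P q \<Longrightarrow> P (p * q)"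
  shows "P p"
proof -
  have one: "P 1" and zero: "P 0"
    using const[of 1] const[of 0] by (simp_all add: mconst_def)
  have pow: "P (q ^ k)" if "P q" for q k
    by (induction k) (simp_all add: one mult that)
  have prod: "P (prod f A)" if "\<And>i. P (f i)" for f :: "'n \<Rightarrow> _" and A
    by (induction A rule: infinite_finite_induct) (simp_all add: one mult that)
  have sum: "P (sum f A)" if "\<And>i. P (f i)" for f :: "('n \<Rightarrow>\<^sub>0 nat) \<Rightarrow> _" and A
    by (induction A rule: infinite_finite_induct) (simp_all add: zero add that)
  have "P (\<Sum>m\<in>Poly_Mapping.keys p. Poly_Mapping.single m (Poly_Mapping.lookup p m))"
    by (rule sum) (auto simp: monomial_eq intro!: mult const prod pow var)
  then show ?thesis by (simp flip: mpoly_sum_monomials)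
qed

lemma mpoly_subst_id [simp]: "mpoly_subst mvar p = p"
  by (induction p rule: mpoly_induct) (simp_all add: mpoly_subst_add mpoly_subst_mult)

lemma mpoly_subst_subst: "mpoly_subst \<sigma> (mpoly_subst \<tau> p) = mpoly_subst (\<lambda>i. mpoly_subst \<sigma> (\<tau> i)) p"
  by (induction p rule: mpoly_induct) (simp_all add: mpoly_subst_add mpoly_subst_mult)

lemma mpoly_deriv_subst:
  "mpoly_deriv j (mpoly_subst \<sigma> p) = (\<Sum>i\<in>UNIV. mpoly_subst \<sigma> (mpoly_deriv i p) * mpoly_deriv j (\<sigma> i))"
proof (induction p rule: mpoly_induct)
  case (var k)
  have "(\<Sum>i\<in>UNIV. mpoly_subst \<sigma> (mpoly_deriv i (mvar k)) * mpoly_deriv j (\<sigma> i)) =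
     (\<Sum>i\<in>UNIV. if i = k then mpoly_deriv j (\<sigma> i) else 0)"
    by (rule sum.cong) (auto simp: mpoly_deriv_mvar)
  then show ?case by simp
qed (simp_all add: mpoly_subst_add mpoly_subst_mult mpoly_deriv_add mpoly_deriv_mult
      algebra_simps sum.distrib sum_distrib_left)

lemma monoid_poly_End: "monoid poly_End"
  by (rule monoidI) (auto simp: poly_End_def poly_map_comp_def mpoly_subst_subst)

lemma group_GA: "group GA"
  unfolding GA_def by (rule monoid.units_group[OF monoid_poly_End])

lemma mult_GA: "mult GA = poly_map_comp"
  by (simp add: GA_def units_of_def poly_End_def)

lemma one_GA: "one GA = mvar"
  by (simp add: GA_def units_of_def poly_End_def)

lemma carrier_GA:
  "carrier GA = {\<phi>. \<exists>\<psi>. poly_map_comp \<psi> \<phi> = mvar \<and> poly_map_comp \<phi> \<psi> = mvar}"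
  by (auto simp: GA_def units_of_def poly_End_def Units_def)

lemma mpoly_subst_det:
  fixes A :: "('n::finite, 'k::comm_ring_1) mpoly ^ 'm::finite ^ 'm"
  shows "mpoly_subst \<sigma> (det A) = det (\<chi> i j. mpoly_subst \<sigma> (A $ i $ j))"
proof -
  have neg: "mpoly_subst \<sigma> (- p) = - mpoly_subst \<sigma> p" for p
    using mpoly_subst_add[of \<sigma> p "- p"] by (simp add: eq_neg_iff_add_eq_0 add.commute)
  have prod: "mpoly_subst \<sigma> (prod f S) = (\<Prod>i\<in>S. mpoly_subst \<sigma> (f i))"
    for f :: "'m \<Rightarrow> ('n, 'k) mpoly" and S
    by (induction S rule: infinite_finite_induct) (simp_all add: mpoly_subst_mult)
  show ?thesis
    unfolding det_def mpoly_subst_sum mpoly_subst_mult prod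
    by (rule sum.cong) (auto simp: sign_def neg)
qed

lemma jacobian_comp:
  "jacobian (poly_map_comp \<phi> \<psi>) = (\<chi> i j. mpoly_subst \<psi> (jacobian \<phi> $ i $ j)) ** jacobian \<psi>"
  by (simp add: jacobian_def poly_map_comp_def mpoly_deriv_subst matrix_matrix_mult_def vec_eq_iff)

lemma det_jacobian_comp:
  "det (jacobian (poly_map_comp \<phi> \<psi>)) = mpoly_subst \<psi> (det (jacobian \<phi>)) * det (jacobian \<psi>)"
  by (simp add: jacobian_comp det_mul mpoly_subst_det)

lemma det_jacobian_mvar [simp]: "det (jacobian (mvar :: ('a::finite, 'b::comm_ring_1) poly_map)) = 1"
proof -
  have "jacobian mvar = (mat 1 :: ('a, 'b) mpoly ^ 'a ^ 'a)"
    by (simp add: jacobian_def mat_def vec_eq_iff mpoly_deriv_mvar)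
  then show ?thesis by simp
qed

lemma subgroup_SA: "subgroup (carrier SA) GA"
proof -
  interpret group GA by (rule group_GA)
  show ?thesis
  proof (rule subgroupI)
    show "carrier SA \<subseteq> carrier GA" by (auto simp: SA_def)
    have "\<one>\<^bsub>GA\<^esub> \<in> carrier SA" by (simp add: SA_def) (simp add: one_GA)
    then show "carrier SA \<noteq> {}" by blast
  next
    fix \<phi> :: "('a, 'b) poly_map" assume "\<phi> \<in> carrier SA"
    then have \<phi>: "\<phi> \<in> carrier GA" "det (jacobian \<phi>) = 1" by (auto simp: SA_def)
    then have "poly_map_comp \<phi> (inv\<^bsub>GA\<^esub> \<phi>) = mvar"
      using r_inv[of \<phi>] by (simp add: mult_GA one_GA)
    then have "det (jacobian (inv\<^bsub>GA\<^esub> \<phi>)) = 1"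
      using det_jacobian_comp[of \<phi> "inv\<^bsub>GA\<^esub> \<phi>"] \<phi> by simp
    then show "inv\<^bsub>GA\<^esub> \<phi> \<in> carrier SA" using \<phi> by (simp add: SA_def)
  next
    fix \<phi> \<psi> :: "('a, 'b) poly_map" assume "\<phi> \<in> carrier SA" "\<psi> \<in> carrier SA"
    then show "\<phi> \<otimes>\<^bsub>GA\<^esub> \<psi> \<in> carrier SA"
      using m_closed[of \<phi> \<psi>] by (simp add: SA_def mult_GA det_jacobian_comp)
  qed
qed

lemma group_SA: "group SA"
  using group.subgroup_imp_group[OF group_GA subgroup_SA] by (simp add: SA_def)

lemma poly_map_comp_linear:
  "poly_map_comp (linear_poly_map A) (linear_poly_map B) = linear_poly_map (A ** B)"
proof (rule ext)
  fix i
  have mconst_sum: "mconst (sum f S) = (\<Sum>k\<in>S. mconst (f k))" for f :: "'a \<Rightarrow> 'b" and S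
    by (induction S rule: infinite_finite_induct) (simp_all add: mconst_def single_add)
  show "poly_map_comp (linear_poly_map A) (linear_poly_map B) i = linear_poly_map (A ** B) i"
    by (simp add: poly_map_comp_def linear_poly_map_def mpoly_subst_sum mpoly_subst_mult
        matrix_matrix_mult_def mconst_sum mconst_mult sum_distrib_left sum_distrib_right mult.assoc)
      (rule sum.swap)
qed

lemma linear_poly_map_id: "linear_poly_map (mat 1) = mvar"
proof (rule ext)
  fix i
  have "linear_poly_map (mat 1) i = (\<Sum>j\<in>UNIV. if j = i then mvar j else 0)"
    unfolding linear_poly_map_def by (rule sum.cong) (auto simp: mat_def mconst_def)
  then show "linear_poly_map (mat 1) i = mvar i" by simp
qed

lemma SL_subset_SA: "(SL :: ('n::finite, 'k::field) poly_map set) \<subseteq> carrier SA"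
proof
  fix \<phi> :: "('n, 'k) poly_map" assume "\<phi> \<in> SL"
  then obtain A where A: "\<phi> = linear_poly_map A" "det A = 1" by (auto simp: SL_def)
  then obtain B where B: "A ** B = mat 1" "B ** A = mat 1"
    using invertible_det_nz[of A] by (auto simp: invertible_def)
  have "\<phi> \<in> carrier GA"
    by (auto simp: carrier_GA A intro!: exI[of _ "linear_poly_map B"])
      (simp_all add: poly_map_comp_linear B linear_poly_map_id)
  moreover have "jacobian \<phi> = (\<chi> i j. mconst (A $ i $ j))"
  proof -
    have "mpoly_deriv j (linear_poly_map A i) = (\<Sum>k\<in>UNIV. if k = j then mconst (A $ i $ k) else 0)" for i j
      unfolding linear_poly_map_def mpoly_deriv_sum
      by (rule sum.cong) (auto simp: mpoly_deriv_mult mpoly_deriv_mvar)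
    then show ?thesis by (simp add: jacobian_def A vec_eq_iff)
  qed
  moreover have "det (\<chi> i j. mconst (A $ i $ j)) = mconst (det A)"
  proof -
    have sum: "mconst (sum f S) = (\<Sum>k\<in>S. mconst (f k))" for f :: "('n \<Rightarrow> 'n) \<Rightarrow> 'k" and S
      by (induction S rule: infinite_finite_induct) (simp_all add: mconst_def single_add)
    have prod: "mconst (prod f S) = (\<Prod>k\<in>S. mconst (f k))" for f :: "'n \<Rightarrow> 'k" and S
      by (induction S rule: infinite_finite_induct) (simp_all add: mconst_mult)
    show ?thesis
      unfolding det_def sum mconst_mult prod
      by (rule sum.cong) (auto simp: sign_def mconst_def single_uminus)
  qed
  ultimately show "\<phi> \<in> carrier SA" by (simp add: SA_def A)
qed

lemma normal_closure_normal:
  assumes "group G" "H \<subseteq> carrier G"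
  shows "normal_closure G H \<lhd> G" "H \<subseteq> normal_closure G H"
proof -
  interpret group G by fact
  have G: "carrier G \<lhd> G" by (auto simp: normal_inv_iff subgroup_self)
  show "H \<subseteq> normal_closure G H" by (auto simp: normal_closure_def)
  have "subgroup (normal_closure G H) G"
    unfolding normal_closure_def
    by (rule subgroups_Inter) (use G assms in \<open>auto simp: normal_imp_subgroup\<close>)
  then show "normal_closure G H \<lhd> G"
    by (auto simp: normal_inv_iff normal_closure_def)
qed

end

theory Submission
  imports Defs
begin

text \<open>
  Suppose a normal subgroup \<open>N\<close> of \<open>SA\<close> contains no nontrivial translation. Then an element of \<open>N\<close> that
  conjugates some nontrivial translation to a translation is trivial: up to a linear change it
  commutes with the translation along the last variable \<open>x\<^sub>n\<close>, and its commutator with a shear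
  \<open>x\<^sub>n + x\<^sub>i\<close> is a unipotent triangular element of \<open>N\<close>, from which iterated commutators with
  translations produce a nontrivial translation.

  Let now \<open>X = \<tau>\<^sub>1 \<alpha>\<^sub>1 \<tau>\<^sub>2 \<alpha>\<^sub>2 \<tau>\<^sub>3 \<alpha>\<^sub>3 \<tau>\<^sub>4 \<alpha>\<^sub>4\<close> lie in \<open>N\<close>, where the \<open>\<tau>\<^sub>i\<close> are unipotent triangular and hence
  commute with the translation \<open>z\<close> along \<open>x\<^sub>n\<close>. For \<open>v = \<alpha>\<^sub>4\<^sup>-\<^sup>1 z \<alpha>\<^sub>4\<close> the commutator of \<open>X\<close> with \<open>v\<close> is
  conjugate to \<open>a b\<close>, where \<open>a\<close> is the conjugate of a triangular map by \<open>g = \<tau>\<^sub>2 \<alpha>\<^sub>2\<close> and \<open>b\<close> is the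
  conjugate of a triangular map by an affine one. The triangular map \<open>\<rho> = g z g\<^sup>-\<^sup>1\<close> commutes with \<open>a\<close>,
  hence modulo \<open>N\<close> with \<open>b\<close>. Replacing \<open>b\<close> by its commutators with \<open>z\<close>, a nilpotent process, shows
  that \<open>\<rho>\<close> really commutes with \<open>b\<close>. So \<open>a b \<in> N\<close> commutes with \<open>g z g\<^sup>-\<^sup>1\<close> and is trivial; therefore
  \<open>X\<close> commutes with \<open>v\<close> and is trivial as well.

  Hence \<open>\<langle>\<phi>\<rangle>\<^sup>S\<close> contains a translation, then all translations, and by commutators with quadratic
  shears all transvections, so that it contains \<open>SL\<close>. Conversely a triangular automorphism is a
  product of monomial shears up to a diagonal map, and these are commutators with diagonal matrices.
\<close>

section \<open>Words in an abstract group\<close>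

context group
begin

definition conj_by where "conj_by g x = g \<otimes> x \<otimes> inv g"

lemma conj_by_closed [simp]: "g \<in> carrier G \<Longrightarrow> x \<in> carrier G \<Longrightarrow> conj_by g x \<in> carrier G"
  by (simp add: conj_by_def)

lemma conj_by_conj_by:
  "g \<in> carrier G \<Longrightarrow> h \<in> carrier G \<Longrightarrow> x \<in> carrier G \<Longrightarrow> conj_by g (conj_by h x) = conj_by (g \<otimes> h) x"
  by (simp add: conj_by_def m_assoc inv_mult_group)

lemma conj_by_mult:
  assumes "g \<in> carrier G" "x \<in> carrier G" "y \<in> carrier G"
  shows "conj_by g (x \<otimes> y) = conj_by g x \<otimes> conj_by g y"
proof -
  have "inv g \<otimes> (g \<otimes> (y \<otimes> inv g)) = y \<otimes> inv g"
    using assms by (simp add: m_assoc[symmetric])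
  then show ?thesis using assms by (simp add: conj_by_def m_assoc)
qed

lemma conj_by_inv: "g \<in> carrier G \<Longrightarrow> x \<in> carrier G \<Longrightarrow> conj_by g (inv x) = inv (conj_by g x)"
  by (simp add: conj_by_def m_assoc inv_mult_group)

lemma conj_by_one [simp]: "g \<in> carrier G \<Longrightarrow> conj_by g \<one> = \<one>"
  by (simp add: conj_by_def)

lemma conj_by_by_one [simp]: "x \<in> carrier G \<Longrightarrow> conj_by \<one> x = x"
  by (simp add: conj_by_def)

lemma conj_by_inv_conj_by [simp]:
  "g \<in> carrier G \<Longrightarrow> x \<in> carrier G \<Longrightarrow> conj_by (inv g) (conj_by g x) = x"
  "g \<in> carrier G \<Longrightarrow> x \<in> carrier G \<Longrightarrow> conj_by g (conj_by (inv g) x) = x"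
  by (simp_all add: conj_by_conj_by)

lemma conj_by_eq_self_iff:
  "g \<in> carrier G \<Longrightarrow> x \<in> carrier G \<Longrightarrow> conj_by g x = x \<longleftrightarrow> g \<otimes> x = x \<otimes> g"
  unfolding conj_by_def by (metis inv_closed inv_solve_right m_closed)

lemma conj_by_eq_self_commute:
  "g \<in> carrier G \<Longrightarrow> x \<in> carrier G \<Longrightarrow> conj_by g x = x \<longleftrightarrow> conj_by x g = g"
  by (auto simp: conj_by_eq_self_iff)

lemma conj_by_of_conj_by:
  "b \<in> carrier G \<Longrightarrow> r \<in> carrier G \<Longrightarrow> x \<in> carrier G \<Longrightarrow>
    conj_by (conj_by b r) x = conj_by b (conj_by r (conj_by (inv b) x))"
  by (simp add: conj_by_conj_by) (simp add: conj_by_def m_assoc)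

lemma conj_by_eq_one_iff: "g \<in> carrier G \<Longrightarrow> x \<in> carrier G \<Longrightarrow> conj_by g x = \<one> \<longleftrightarrow> x = \<one>"
  by (metis conj_by_inv_conj_by(1) conj_by_one inv_closed)

end

text \<open>Reduces a conjugation to an intertwining relation, so that no inverse of a polynomial
  map has to be written out.\<close>

lemma group_conj_by_eqI:
  assumes "group G" "g \<in> carrier G" "x \<in> carrier G" "y \<in> carrier G" "g \<otimes>\<^bsub>G\<^esub> x = y \<otimes>\<^bsub>G\<^esub> g"
  shows "group.conj_by G g x = y" "group.conj_by G (inv\<^bsub>G\<^esub> g) y = x"
proof -
  interpret group G by fact
  have "conj_by g x = (y \<otimes>\<^bsub>G\<^esub> g) \<otimes>\<^bsub>G\<^esub> inv\<^bsub>G\<^esub> g" using assms by (simp add: conj_by_def)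
  then show *: "conj_by g x = y" using assms by (simp add: m_assoc)
  show "conj_by (inv\<^bsub>G\<^esub> g) y = x" using assms by (simp add: *[symmetric])
qed

lemma (in normal) conj_by_mem: "g \<in> carrier G \<Longrightarrow> x \<in> H \<Longrightarrow> conj_by g x \<in> H"
  by (simp add: conj_by_def inv_op_closed2)

lemma (in normal) conj_by_mem_iff: "g \<in> carrier G \<Longrightarrow> x \<in> carrier G \<Longrightarrow> conj_by g x \<in> H \<longleftrightarrow> x \<in> H"
  by (metis conj_by_inv_conj_by(1) conj_by_mem inv_closed)

lemma (in normal) commutator_mem:
  assumes "x \<in> H" "v \<in> carrier G"
  shows "conj_by x v \<otimes> inv v \<in> H"
proof -
  have "conj_by x v \<otimes> inv v = x \<otimes> conj_by v (inv x)"
    using assms by (simp add: conj_by_def m_assoc)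
  then show ?thesis using assms by (simp add: conj_by_mem)
qed

text \<open>This set is the preimage of the centralizer of the class of \<open>r\<close> in the
  quotient by \<open>H\<close>.\<close>

lemma (in normal) subgroup_commuting_mod:
  assumes "r \<in> carrier G"
  shows "subgroup {x \<in> carrier G. conj_by x r \<otimes> inv r \<in> H} G"
proof (rule subgroupI)
  show "{x \<in> carrier G. conj_by x r \<otimes> inv r \<in> H} \<noteq> {}"
    using assms by (auto intro!: exI[of _ \<one>])
next
  fix x assume "x \<in> {x \<in> carrier G. conj_by x r \<otimes> inv r \<in> H}"
  then have x: "x \<in> carrier G" "conj_by x r \<otimes> inv r \<in> H" by auto
  have "conj_by (inv x) r \<otimes> inv r = conj_by (inv x) (inv (conj_by x r \<otimes> inv r))"
    using assms x by (simp add: inv_mult_group conj_by_mult conj_by_inv)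
  then show "inv x \<in> {x \<in> carrier G. conj_by x r \<otimes> inv r \<in> H}"
    using assms x by (simp add: conj_by_mem)
next
  fix x y assume "x \<in> {x \<in> carrier G. conj_by x r \<otimes> inv r \<in> H}" "y \<in> {x \<in> carrier G. conj_by x r \<otimes> inv r \<in> H}"
  then have x: "x \<in> carrier G" "conj_by x r \<otimes> inv r \<in> H" and y: "y \<in> carrier G" "conj_by y r \<otimes> inv r \<in> H"
    by auto
  have "conj_by (x \<otimes> y) r \<otimes> inv r = conj_by x (conj_by y r \<otimes> inv r) \<otimes> (conj_by x r \<otimes> inv r)"
    using assms x y by (simp add: conj_by_mult conj_by_inv conj_by_conj_by[symmetric] m_assoc)
      (simp add: m_assoc[symmetric])
  then show "x \<otimes> y \<in> {x \<in> carrier G. conj_by x r \<otimes> inv r \<in> H}"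
    using assms x y by (simp add: conj_by_mem)
qed auto

section \<open>The commutator argument in an abstract group\<close>

text \<open>\<open>U\<close> stands for the unipotent triangular maps, \<open>Tr\<close> for the
  translations and \<open>z\<close> for the translation along the largest variable.
  \<open>rigid\<close> is what \<open>normal_rigid\<close> supplies when \<open>N\<close> contains
  no nontrivial translation.\<close>

locale rigid_normal = normal N G for N and G (structure) +
  fixes U Tr :: "'a set" and z :: 'a
  assumes subgroup_U: "subgroup U G"
    and Tr_subset: "Tr \<subseteq> U"
    and z_mem: "z \<in> Tr" and z_nontrivial: "z \<noteq> \<one>"
    and z_central: "u \<in> U \<Longrightarrow> u \<otimes> z = z \<otimes> u"
    and nilpotent: "s \<in> U \<Longrightarrow> t \<in> Tr \<Longrightarrow> \<exists>k. ((\<lambda>s. inv s \<otimes> inv t \<otimes> s \<otimes> t) ^^ k) s = \<one>"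
    and rigid: "x \<in> N \<Longrightarrow> t \<in> Tr \<Longrightarrow> t \<noteq> \<one> \<Longrightarrow> conj_by x t \<in> Tr \<Longrightarrow> x = \<one>"
begin

lemma U_closed [simp]: "u \<in> U \<Longrightarrow> u \<in> carrier G"
  by (rule subgroup.mem_carrier[OF subgroup_U])

lemma Tr_closed [simp]: "t \<in> Tr \<Longrightarrow> t \<in> carrier G"
  using Tr_subset by auto

lemma z_closed [simp]: "z \<in> carrier G"
  by (simp add: z_mem)

lemma conj_by_z [simp]: "u \<in> U \<Longrightarrow> conj_by u z = z"
  by (simp add: conj_by_eq_self_iff z_central)

lemma conj_by_U: "u \<in> U \<Longrightarrow> v \<in> U \<Longrightarrow> conj_by u v \<in> U"
  using subgroup.m_closed[OF subgroup_U] subgroup.m_inv_closed[OF subgroup_U] by (simp add: conj_by_def)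

lemma inv_U: "u \<in> U \<Longrightarrow> inv u \<in> U"
  by (rule subgroup.m_inv_closed[OF subgroup_U])

text \<open>Induction on the number of commutators with \<open>s = conj_by (inv g) z\<close> that
  kill \<open>\<sigma>\<close>. With \<open>b = conj_by g \<sigma>\<close>, both \<open>b\<close>
  and \<open>z\<close> commute with \<open>\<rho>\<close> modulo \<open>N\<close>, hence so does
  their commutator \<open>b1\<close>, which by induction commutes with \<open>\<rho>\<close>
  exactly. This makes the commutator of \<open>b\<close> and \<open>\<rho>\<close> commute with
  \<open>z\<close>, and rigidity kills it.\<close>

lemma commute_of_commutator_mem:
  assumes g: "g \<in> carrier G" and s: "conj_by (inv g) z \<in> Tr"
    and \<sigma>: "\<sigma> \<in> U" and \<rho>: "\<rho> \<in> U"
    and mem: "conj_by (conj_by g \<sigma>) \<rho> \<otimes> inv \<rho> \<in> N"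
  shows "conj_by (conj_by g \<sigma>) \<rho> = \<rho>"
proof -
  define s where "s = conj_by (inv g) z"
  have s: "s \<in> Tr" and gs: "conj_by g s = z" using s g by (simp_all add: s_def)
  let ?f = "\<lambda>x. inv x \<otimes> inv s \<otimes> x \<otimes> s"
  obtain k where "(?f ^^ k) \<sigma> = \<one>" using nilpotent[OF \<sigma> s] by blast
  then show ?thesis using \<sigma> mem
  proof (induction k arbitrary: \<sigma>)
    case 0
    then show ?case using g \<rho> by simp
  next
    case (Suc k)
    note \<sigma> = Suc.prems(2)
    define b where "b = conj_by g \<sigma>"
    define b1 where "b1 = conj_by g (?f \<sigma>)"
    have b: "b \<in> carrier G" using g \<sigma> by (simp add: b_def)
    have f: "?f \<sigma> \<in> U"
      using \<sigma> s Tr_subset subgroup.m_closed[OF subgroup_U] subgroup.m_inv_closed[OF subgroup_U] by auto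
    \<comment> \<open>\<open>g\<close> carries \<open>s\<close> to \<open>z\<close>, so the
      commutator of \<open>\<sigma>\<close> with \<open>s\<close> becomes that of \<open>b\<close>
      with \<open>z\<close>.\<close>
    have b1: "b1 = inv b \<otimes> inv z \<otimes> b \<otimes> z"
      using g \<sigma> s by (simp add: b_def b1_def conj_by_mult conj_by_inv gs)
    have b1c: "b1 \<in> carrier G" using b by (simp add: b1)
    let ?C = "{x \<in> carrier G. conj_by x \<rho> \<otimes> inv \<rho> \<in> N}"
    have C: "subgroup ?C G" by (rule subgroup_commuting_mod) (use \<rho> in simp)
    have "b \<in> ?C" using b Suc.prems(3) by (simp add: b_def)
    moreover have "z \<in> ?C"
    proof -
      have "conj_by z \<rho> = \<rho>" using \<rho> conj_by_z[OF \<rho>] conj_by_eq_self_commute by simp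
      then show ?thesis using \<rho> by simp
    qed
    ultimately have "b1 \<in> ?C" unfolding b1 by (intro subgroup.m_closed[OF C] subgroup.m_inv_closed[OF C])
    then have "conj_by b1 \<rho> = \<rho>"
      unfolding b1_def
      by (intro Suc.IH) (use f Suc.prems(1)[unfolded funpow_Suc_right o_apply] in auto)
    then have \<rho>b1: "conj_by \<rho> b1 = b1" using b1c \<rho> conj_by_eq_self_commute by simp
    have "conj_by (inv b) z = z \<otimes> inv b1"
      using b by (simp add: b1 conj_by_def inv_mult_group m_assoc) (simp add: m_assoc[symmetric])
    then have *: "conj_by \<rho> (conj_by (inv b) z) = conj_by (inv b) z"
      using \<rho> b1c by (simp add: conj_by_mult conj_by_inv \<rho>b1)
    \<comment> \<open>The conjugations are undone one by one: \<open>inv \<rho>\<close> fixes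
      \<open>z\<close>, and \<open>\<rho>\<close> fixes \<open>conj_by (inv b) z\<close>.\<close>
    have "conj_by (conj_by b \<rho> \<otimes> inv \<rho>) z = conj_by (conj_by b \<rho>) (conj_by (inv \<rho>) z)"
      using b \<rho> by (simp add: conj_by_conj_by)
    also have "\<dots> = z"
      using b \<rho> by (simp add: inv_U conj_by_of_conj_by *)
    finally have "conj_by b \<rho> \<otimes> inv \<rho> = \<one>"
      using Suc.prems(3) z_mem z_nontrivial by (intro rigid[of _ z]) (auto simp: b_def)
    then show ?case
      using b \<rho> by (metis U_closed b_def conj_by_closed inv_closed inv_equality inv_inv)
  qed
qed

text \<open>The conjugate of \<open>v\<close> by \<open>?X\<close> does not see the right half of
  the word: \<open>a4\<close> takes \<open>v\<close> to \<open>z\<close>, which \<open>u4\<close>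
  fixes, and \<open>a3\<close> and \<open>u3\<close> then produce just one element
  \<open>\<sigma>\<close> of \<open>U\<close>. Rigidity is applied twice, first to the commutator of
  \<open>?X\<close> with \<open>v\<close> and then to \<open>?X\<close> itself.\<close>

lemma four_triangular_trivial:
  assumes u: "u1 \<in> U" "u2 \<in> U" "u3 \<in> U" "u4 \<in> U"
    and a: "a1 \<in> carrier G" "a2 \<in> carrier G" "a3 \<in> carrier G" "a4 \<in> carrier G"
    and norm: "conj_by a1 z \<in> Tr" "conj_by a2 z \<in> Tr" "conj_by a3 z \<in> Tr" "conj_by (inv a4) z \<in> Tr"
    and mem: "u1 \<otimes> a1 \<otimes> u2 \<otimes> a2 \<otimes> u3 \<otimes> a3 \<otimes> u4 \<otimes> a4 \<in> N" (is "?X \<in> N")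
  shows "?X = \<one>"
proof -
  note [simp] = u a U_closed[OF u(1)] U_closed[OF u(2)] U_closed[OF u(3)] U_closed[OF u(4)]
  have X: "?X \<in> carrier G" by simp
  define v where "v = conj_by (inv a4) z"
  have v: "v \<in> Tr" using norm by (simp add: v_def)
  have [simp]: "v \<in> carrier G" using v by simp
  define \<sigma> where "\<sigma> = conj_by u3 (conj_by a3 z)"
  define g where "g = u2 \<otimes> a2"
  define h where "h = u1 \<otimes> a1"
  define \<sigma>' where "\<sigma>' = conj_by (inv u1) (inv v)"
  define \<rho> where "\<rho> = conj_by g z"
  have [simp]: "g \<in> carrier G" "h \<in> carrier G" by (simp_all add: g_def h_def)
  have Tr_U: "t \<in> U" if "t \<in> Tr" for t using that Tr_subset by auto
  have \<sigma>: "\<sigma> \<in> U" unfolding \<sigma>_def by (intro conj_by_U u Tr_U norm)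
  have \<sigma>': "\<sigma>' \<in> U" unfolding \<sigma>'_def by (intro conj_by_U inv_U u Tr_U v)
  have "\<rho> = conj_by u2 (conj_by a2 z)" by (simp add: \<rho>_def g_def conj_by_conj_by)
  then have \<rho>: "\<rho> \<in> U" using conj_by_U[OF u(2) Tr_U[OF norm(2)]] by simp
  note [simp] = U_closed[OF \<sigma>] U_closed[OF \<sigma>'] U_closed[OF \<rho>]
  have "conj_by ?X v = conj_by (h \<otimes> g) (conj_by u3 (conj_by a3 (conj_by u4 (conj_by a4 v))))"
    by (simp add: conj_by_conj_by h_def g_def m_assoc)
  then have Xv: "conj_by ?X v = conj_by (h \<otimes> g) \<sigma>"
    by (simp add: v_def \<sigma>_def)
  define a where "a = conj_by g \<sigma>"
  define b where "b = conj_by (inv a1) \<sigma>'"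
  have [simp]: "a \<in> carrier G" "b \<in> carrier G" by (simp_all add: a_def b_def)
  \<comment> \<open>Stripping off \<open>h\<close> splits the commutator into \<open>a\<close>, the
    conjugate by \<open>g\<close> of an element of \<open>U\<close>, and \<open>b\<close>, the
    conjugate by \<open>inv a1\<close> of another one.\<close>
  have "conj_by (inv h) (conj_by ?X v \<otimes> inv v) = a \<otimes> b"
    unfolding Xv by (simp add: conj_by_mult a_def b_def \<sigma>'_def conj_by_conj_by m_assoc[symmetric])
      (simp add: h_def inv_mult_group)
  moreover have "conj_by ?X v \<otimes> inv v \<in> N" by (rule commutator_mem[OF mem]) simp
  ultimately have ab: "a \<otimes> b \<in> N" using conj_by_mem[of "inv h" "conj_by ?X v \<otimes> inv v"] by simp
  \<comment> \<open>\<open>\<sigma>\<close> commutes with \<open>z\<close>; transported by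
    \<open>g\<close>, this says that \<open>a\<close> commutes with \<open>\<rho>\<close>.\<close>
  have "conj_by \<sigma> z = z" by (simp add: \<sigma>)
  then have "conj_by a \<rho> = \<rho>"
    by (simp add: a_def \<rho>_def conj_by_of_conj_by)
  \<comment> \<open>The product of \<open>a\<close> and \<open>b\<close> lies in \<open>N\<close>
    and so commutes with everything modulo \<open>N\<close>. Since \<open>a\<close> commutes with
    \<open>\<rho>\<close>, so does \<open>b\<close> modulo \<open>N\<close>.\<close>
  let ?C = "{x \<in> carrier G. conj_by x \<rho> \<otimes> inv \<rho> \<in> N}"
  have C: "subgroup ?C G" by (rule subgroup_commuting_mod) simp
  have "a \<in> ?C" using \<open>conj_by a \<rho> = \<rho>\<close> by simp
  moreover have "a \<otimes> b \<in> ?C" using commutator_mem[OF ab, of \<rho>] by simp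
  ultimately have "inv a \<otimes> (a \<otimes> b) \<in> ?C"
    by (rule subgroup.m_closed[OF C subgroup.m_inv_closed[OF C]])
  then have "conj_by b \<rho> \<otimes> inv \<rho> \<in> N" by (simp add: m_assoc[symmetric])
  then have "conj_by b \<rho> = \<rho>"
    unfolding b_def using norm by (intro commute_of_commutator_mem \<sigma>' \<rho>) auto
  with \<open>conj_by a \<rho> = \<rho>\<close> have "conj_by (a \<otimes> b) \<rho> = \<rho>" by (simp add: conj_by_conj_by[symmetric])
  then have "conj_by (conj_by (inv g) (a \<otimes> b)) z = z"
    by (simp add: conj_by_of_conj_by \<rho>_def)
  then have "conj_by (inv g) (a \<otimes> b) = \<one>"
    using ab z_mem z_nontrivial by (intro rigid[of _ z]) (auto intro: conj_by_mem)
  then have "a \<otimes> b = \<one>" by (simp add: conj_by_eq_one_iff)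
  then have "conj_by ?X v \<otimes> inv v = \<one>"
    using \<open>conj_by (inv h) (conj_by ?X v \<otimes> inv v) = a \<otimes> b\<close> X by (simp add: conj_by_eq_one_iff)
  then have "conj_by ?X v = v"
    using X by (metis \<open>v \<in> carrier G\<close> conj_by_closed inv_closed inv_equality inv_inv)
  moreover have "v \<noteq> \<one>" using z_nontrivial by (simp add: v_def conj_by_eq_one_iff)
  ultimately show ?thesis using mem v by (intro rigid[of _ v]) auto
qed

end

section \<open>Polynomials\<close>

lemma mpoly_subst_cong:
  assumes "\<And>i. i \<in> mpoly_vars p \<Longrightarrow> \<sigma> i = \<tau> i"
  shows "mpoly_subst \<sigma> p = mpoly_subst \<tau> p"
  unfolding mpoly_subst_def
proof (rule sum.cong[OF refl])
  fix m assume m: "m \<in> Poly_Mapping.keys p"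
  have "\<sigma> i ^ Poly_Mapping.lookup m i = \<tau> i ^ Poly_Mapping.lookup m i" for i
  proof (cases "i \<in> Poly_Mapping.keys m")
    case True
    then have "i \<in> mpoly_vars p" using m by (auto simp: mpoly_vars_def)
    then show ?thesis using assms by simp
  qed (simp add: in_keys_iff)
  then show "mconst (Poly_Mapping.lookup p m) * (\<Prod>i\<in>UNIV. \<sigma> i ^ Poly_Mapping.lookup m i) =
    mconst (Poly_Mapping.lookup p m) * (\<Prod>i\<in>UNIV. \<tau> i ^ Poly_Mapping.lookup m i)" by simp
qed

lemma mpoly_subst_uminus: "mpoly_subst \<sigma> (- p) = - mpoly_subst \<sigma> p"
  using mpoly_subst_add[of \<sigma> p "- p"] by (simp add: eq_neg_iff_add_eq_0 add.commute)

lemma mpoly_subst_diff: "mpoly_subst \<sigma> (p - q) = mpoly_subst \<sigma> p - mpoly_subst \<sigma> q"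
  using mpoly_subst_add[of \<sigma> p "- q"] by (simp add: mpoly_subst_uminus)

lemma mpoly_deriv_uminus: "mpoly_deriv j (- p) = - mpoly_deriv j p"
  using mpoly_deriv_add[of j p "- p"] by (simp add: eq_neg_iff_add_eq_0 add.commute)

lemma mpoly_deriv_diff: "mpoly_deriv j (p - q) = mpoly_deriv j p - mpoly_deriv j q"
  using mpoly_deriv_add[of j p "- q"] by (simp add: mpoly_deriv_uminus)

lemma mconst_0 [simp]: "mconst 0 = 0"
  by (simp add: mconst_def)

lemma mconst_add: "mconst (a + b) = mconst a + mconst b"
  by (simp add: mconst_def single_add)

lemma mconst_uminus: "mconst (- a) = - mconst a"
  by (simp add: mconst_def single_uminus)

lemma mconst_sum: "mconst (sum f S) = (\<Sum>k\<in>S. mconst (f k))"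
  by (induction S rule: infinite_finite_induct) (simp_all add: mconst_add)

lemma mconst_prod: "mconst (prod f S) = (\<Prod>k\<in>S. mconst (f k))"
  by (induction S rule: infinite_finite_induct) (simp_all add: mconst_mult)

lemma mconst_power: "mconst (a ^ k) = mconst a ^ k"
  by (induction k) (simp_all add: mconst_mult)

lemma mconst_eq_iff [simp]: "mconst a = mconst b \<longleftrightarrow> a = b"
  unfolding mconst_def by (metis lookup_single_eq)

lemma mconst_eq_0_iff [simp]: "mconst a = 0 \<longleftrightarrow> a = 0"
  using mconst_eq_iff[of a 0] by (simp del: mconst_eq_iff)

lemma mconst_eq_1_iff [simp]: "mconst a = 1 \<longleftrightarrow> a = 1"
  using mconst_eq_iff[of a 1] by (simp del: mconst_eq_iff)

lemma mpoly_vars_mconst [simp]: "mpoly_vars (mconst c) = {}"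
  by (simp add: mpoly_vars_def mconst_def)

lemma mpoly_vars_0 [simp]: "mpoly_vars 0 = {}"
  by (simp add: mpoly_vars_def)

lemma mpoly_vars_1 [simp]: "mpoly_vars (1 :: ('n, 'k::zero_neq_one) mpoly) = {}"
  by (simp add: mpoly_vars_def)

lemma mpoly_vars_mvar [simp]: "mpoly_vars (mvar i :: ('n, 'k::zero_neq_one) mpoly) = {i}"
  by (simp add: mpoly_vars_def mvar_def)

lemma mpoly_vars_add: "mpoly_vars (p + q) \<subseteq> mpoly_vars p \<union> mpoly_vars q"
  using Poly_Mapping.keys_add[of p q] by (auto simp: mpoly_vars_def)

lemma mpoly_vars_uminus [simp]: "mpoly_vars (- p :: ('n, 'k::comm_ring_1) mpoly) = mpoly_vars p"
  by (simp add: mpoly_vars_def)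

lemma mpoly_vars_mult: "mpoly_vars (p * q) \<subseteq> mpoly_vars p \<union> mpoly_vars q"
proof
  fix i assume "i \<in> mpoly_vars (p * q)"
  then obtain m where m: "m \<in> Poly_Mapping.keys (p * q)" "i \<in> Poly_Mapping.keys m"
    by (auto simp: mpoly_vars_def)
  then obtain a b where "m = a + b" "a \<in> Poly_Mapping.keys p" "b \<in> Poly_Mapping.keys q"
    using keys_mult[of p q] by blast
  then show "i \<in> mpoly_vars p \<union> mpoly_vars q"
    using m Poly_Mapping.keys_add[of a b] by (auto simp: mpoly_vars_def)
qed

lemma mpoly_vars_sum: "mpoly_vars (sum f A) \<subseteq> (\<Union>a\<in>A. mpoly_vars (f a))"
  by (induction A rule: infinite_finite_induct) (use mpoly_vars_add in fastforce)+

lemma mpoly_vars_prod: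
  "mpoly_vars (prod f A :: ('n, 'k::comm_ring_1) mpoly) \<subseteq> (\<Union>a\<in>A. mpoly_vars (f a))"
  by (induction A rule: infinite_finite_induct) (use mpoly_vars_mult in fastforce)+

lemma mpoly_vars_power: "mpoly_vars (p ^ k :: ('n, 'k::comm_ring_1) mpoly) \<subseteq> mpoly_vars p"
  by (induction k) (use mpoly_vars_mult in fastforce)+

lemma mpoly_vars_subst: "mpoly_vars (mpoly_subst \<sigma> p) \<subseteq> (\<Union>i\<in>mpoly_vars p. mpoly_vars (\<sigma> i))"
proof
  fix j assume "j \<in> mpoly_vars (mpoly_subst \<sigma> p)"
  then obtain m where m: "m \<in> Poly_Mapping.keys p"
    and "j \<in> mpoly_vars (mconst (Poly_Mapping.lookup p m) * (\<Prod>i\<in>UNIV. \<sigma> i ^ Poly_Mapping.lookup m i))"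
    unfolding mpoly_subst_def using mpoly_vars_sum by fastforce
  then have "j \<in> mpoly_vars (\<Prod>i\<in>UNIV. \<sigma> i ^ Poly_Mapping.lookup m i)"
    using mpoly_vars_mult by fastforce
  then obtain i where i: "j \<in> mpoly_vars (\<sigma> i ^ Poly_Mapping.lookup m i)"
    using mpoly_vars_prod by fastforce
  then have "Poly_Mapping.lookup m i \<noteq> 0" by (intro notI) simp
  then have "i \<in> mpoly_vars p" using m unfolding mpoly_vars_def by (blast intro: in_keys_iff[THEN iffD2])
  moreover have "j \<in> mpoly_vars (\<sigma> i)" using i mpoly_vars_power by fastforce
  ultimately show "j \<in> (\<Union>i\<in>mpoly_vars p. mpoly_vars (\<sigma> i))" by blast
qed

lemma mpoly_deriv_eq_0:
  assumes "j \<notin> mpoly_vars p"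
  shows "mpoly_deriv j p = 0"
  unfolding mpoly_deriv_def
proof (rule sum.neutral, rule ballI)
  fix m assume "m \<in> Poly_Mapping.keys p"
  then have "j \<notin> Poly_Mapping.keys m" using assms by (auto simp: mpoly_vars_def)
  then show "Poly_Mapping.single (m - Poly_Mapping.single j 1)
       (of_nat (Poly_Mapping.lookup m j) * Poly_Mapping.lookup p m) = 0"
    by (simp add: in_keys_iff)
qed

text \<open>A polynomial without variables is unchanged when every variable is replaced by
  \<open>0\<close>, and this substitution turns any polynomial into a constant.\<close>

lemma mpoly_vars_empty_imp_mconst:
  fixes p :: "('n::finite, 'k::comm_ring_1) mpoly"
  assumes "mpoly_vars p = {}"
  shows "\<exists>c. p = mconst c"
proof -
  have "p = mpoly_subst (\<lambda>_. 0) p"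
    using mpoly_subst_cong[of p mvar "\<lambda>_. 0"] assms by simp
  also have "\<exists>c. mpoly_subst (\<lambda>_. 0) p = mconst c"
  proof (induction p rule: mpoly_induct)
    case (const c) then show ?case by auto
  next
    case (var i) then show ?case by (auto intro: exI[of _ 0])
  next
    case (add p q) then show ?case by (metis mconst_add mpoly_subst_add)
  next
    case (mult p q) then show ?case by (metis mconst_mult mpoly_subst_mult)
  qed
  finally show ?thesis .
qed

section \<open>Affine maps\<close>

definition affine_map :: "'k::comm_ring_1 ^ 'n ^ 'n \<Rightarrow> 'k ^ 'n \<Rightarrow> ('n::finite, 'k) poly_map" where
  "affine_map A v = (\<lambda>i. (\<Sum>j\<in>UNIV. mconst (A $ i $ j) * mvar j) + mconst (v $ i))"

definition transl :: "'k::comm_ring_1 ^ 'n \<Rightarrow> ('n::finite, 'k) poly_map" where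
  "transl v = (\<lambda>i. mvar i + mconst (v $ i))"

lemma transl_apply: "transl w i = mvar i + mconst (w $ i)"
  by (simp add: transl_def)

lemma transl_eq_affine_map: "transl v = affine_map (mat 1) v"
  by (simp add: transl_def affine_map_def fun_cong[OF linear_poly_map_id, unfolded linear_poly_map_def])

lemma linear_eq_affine_map: "linear_poly_map A = affine_map A 0"
  by (simp add: linear_poly_map_def affine_map_def)

lemma affine_map_one: "affine_map (mat 1) 0 = mvar"
  by (metis linear_eq_affine_map linear_poly_map_id)

lemma affine_map_comp:
  "poly_map_comp (affine_map A v) (affine_map B w) = affine_map (A ** B) (A *v w + v)"
proof (rule ext)
  fix i
  have "(\<Sum>j\<in>UNIV. \<Sum>k\<in>UNIV. mconst (A $ i $ j) * (mconst (B $ j $ k) * mvar k)) =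
     (\<Sum>k\<in>UNIV. \<Sum>j\<in>UNIV. mconst (A $ i $ j) * (mconst (B $ j $ k) * mvar k))"
    by (rule sum.swap)
  then show "poly_map_comp (affine_map A v) (affine_map B w) i = affine_map (A ** B) (A *v w + v) i"
    by (simp add: poly_map_comp_def affine_map_def mpoly_subst_add mpoly_subst_sum mpoly_subst_mult
        matrix_matrix_mult_def matrix_vector_mult_def mconst_sum mconst_add mconst_mult sum_distrib_left
        sum_distrib_right mult.assoc distrib_left sum.distrib)
qed

lemma transl_comp: "poly_map_comp (transl v) (transl w) = transl (v + w)"
  by (simp add: transl_eq_affine_map affine_map_comp add.commute)

lemma affine_map_transl:
  "poly_map_comp (affine_map A u) (transl v) = poly_map_comp (transl (A *v v)) (affine_map A u)"
  by (simp add: transl_eq_affine_map affine_map_comp add.commute)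

lemma transl_0: "transl 0 = mvar"
  by (simp add: transl_def)

lemma transl_eq_iff [simp]: "transl v = transl w \<longleftrightarrow> v = w"
  by (auto simp: transl_def fun_eq_iff vec_eq_iff)

lemma transl_eq_mvar_iff [simp]: "transl v = mvar \<longleftrightarrow> v = 0"
  using transl_eq_iff[of v 0] by (simp add: transl_0 del: transl_eq_iff)

lemma jacobian_affine_map: "jacobian (affine_map A v) = (\<chi> i j. mconst (A $ i $ j))"
proof -
  have "mpoly_deriv j (affine_map A v i) = (\<Sum>k\<in>UNIV. if k = j then mconst (A $ i $ k) else 0)" for i j
    unfolding affine_map_def mpoly_deriv_sum mpoly_deriv_add mpoly_deriv_mconst add_0_right
    by (rule sum.cong) (auto simp: mpoly_deriv_mult mpoly_deriv_mvar)
  then show ?thesis by (simp add: jacobian_def vec_eq_iff)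
qed

lemma det_jacobian_affine_map: "det (jacobian (affine_map A v)) = mconst (det A)"
  unfolding jacobian_affine_map det_def mconst_sum mconst_mult mconst_prod
  by (rule sum.cong) (auto simp: sign_def mconst_uminus)

lemma affine_map_in_GA:
  fixes A :: "'k::field ^ 'n ^ 'n::finite"
  shows "affine_map A v \<in> carrier GA \<longleftrightarrow> det A \<noteq> 0"
proof
  assume "affine_map A v \<in> carrier GA"
  then obtain \<psi> where "poly_map_comp \<psi> (affine_map A v) = mvar" by (auto simp: carrier_GA)
  \<comment> \<open>By the chain rule \<open>mconst (det A)\<close> divides
    \<open>1\<close>.\<close>
  then have "mpoly_subst (affine_map A v) (det (jacobian \<psi>)) * mconst (det A) = 1"
    using det_jacobian_comp[of \<psi> "affine_map A v"] by (simp add: det_jacobian_affine_map)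
  then show "det A \<noteq> 0" by auto
next
  assume "det A \<noteq> 0"
  then obtain B where B: "A ** B = mat 1" "B ** A = mat 1"
    using invertible_det_nz[of A] by (auto simp: invertible_def)
  have "poly_map_comp (affine_map B (- (B *v v))) (affine_map A v) = mvar"
    by (simp add: affine_map_comp B affine_map_one)
  moreover have "poly_map_comp (affine_map A v) (affine_map B (- (B *v v))) = mvar"
    by (simp add: affine_map_comp B affine_map_one matrix_vector_mul_assoc vec.neg)
  ultimately show "affine_map A v \<in> carrier GA" by (auto simp: carrier_GA)
qed

lemma affine_map_in_SA: "affine_map A v \<in> carrier SA \<longleftrightarrow> det A = 1"
  by (auto simp: SA_def affine_map_in_GA det_jacobian_affine_map)

lemma transl_in_SA [simp]: "transl v \<in> carrier SA"
  by (simp add: transl_eq_affine_map affine_map_in_SA)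

lemma mult_SA: "mult SA = poly_map_comp"
  by (simp add: SA_def mult_GA)

lemma one_SA: "one SA = mvar"
  by (simp add: SA_def one_GA)

text \<open>The polynomials satisfying \<open>lin\<close> are closed under addition, so it suffices
  to treat a monomial; a total exponent of at most one makes it a constant or a multiple of a single
  variable.\<close>

lemma affine_map_eqI:
  fixes p :: "('n::finite, 'k::comm_ring_1) poly_map"
  assumes "\<And>i. mpoly_degree (p i) \<le> 1"
  shows "\<exists>A v. p = affine_map A v"
proof -
  have "\<exists>a c. p i = (\<Sum>j\<in>UNIV. mconst (a j) * mvar j) + mconst c" for i
  proof -
    have deg: "(\<Sum>j\<in>UNIV. Poly_Mapping.lookup m j) \<le> 1" if "m \<in> Poly_Mapping.keys (p i)" for m
    proof -
      have "(\<Sum>j\<in>UNIV. Poly_Mapping.lookup m j) \<le> mpoly_degree (p i)"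
        unfolding mpoly_degree_def using that by (intro Max_ge) auto
      then show ?thesis using assms[of i] by simp
    qed
    define lin :: "('n, 'k) mpoly \<Rightarrow> bool" where
      "lin q \<longleftrightarrow> (\<exists>a c. q = (\<Sum>j\<in>UNIV. mconst (a j) * mvar j) + mconst c)" for q
    have add: "lin (q + r)" if q: "lin q" and r: "lin r" for q r
    proof -
      obtain a c where "q = (\<Sum>j\<in>UNIV. mconst (a j) * mvar j) + mconst c" using q by (auto simp: lin_def)
      moreover obtain b d where "r = (\<Sum>j\<in>UNIV. mconst (b j) * mvar j) + mconst d" using r by (auto simp: lin_def)
      ultimately have "q + r = (\<Sum>j\<in>UNIV. mconst (a j + b j) * mvar j) + mconst (c + d)"
        by (simp add: mconst_add distrib_right sum.distrib)
      then show ?thesis unfolding lin_def by (intro exI)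
    qed
    have zero: "lin 0" unfolding lin_def by (rule exI[of _ "\<lambda>_. 0"], rule exI[of _ 0]) simp
    have sum: "lin (sum f S)" if "\<And>x. x \<in> S \<Longrightarrow> lin (f x)" for f :: "('n \<Rightarrow>\<^sub>0 nat) \<Rightarrow> _" and S
      using that by (induction S rule: infinite_finite_induct) (auto simp: zero intro!: add)
    have single: "lin (Poly_Mapping.single m c)" if m: "(\<Sum>j\<in>UNIV. Poly_Mapping.lookup m j) \<le> 1" for m c
    proof (cases "m = 0")
      case True
      then show ?thesis unfolding lin_def by (intro exI[of _ "\<lambda>_. 0"] exI[of _ c]) (simp add: mconst_def)
    next
      case False
      then obtain j where j0: "Poly_Mapping.lookup m j \<noteq> 0" by (auto simp: poly_mapping_eq_iff fun_eq_iff)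
      have split: "(\<Sum>k\<in>UNIV. Poly_Mapping.lookup m k) = Poly_Mapping.lookup m j + (\<Sum>k\<in>UNIV - {j}. Poly_Mapping.lookup m k)"
        by (rule sum.remove) auto
      have j: "Poly_Mapping.lookup m j = 1" using split j0 m by linarith
      have "(\<Sum>k\<in>UNIV - {j}. Poly_Mapping.lookup m k) = 0" using split j m by linarith
      then have "Poly_Mapping.lookup m k = (if k = j then 1 else 0)" for k
        using j by (cases "k = j") (simp_all add: sum_eq_0_iff)
      then have "m = Poly_Mapping.single j 1"
        by (intro poly_mapping_eqI) (simp add: lookup_single when_def)
      then have "Poly_Mapping.single m c = mconst c * mvar j"
        by (simp add: mconst_def mvar_def mult_single)
      also have "\<dots> = (\<Sum>k\<in>UNIV. mconst (if k = j then c else 0) * mvar k) + mconst 0"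
        by (simp add: if_distrib[where f = mconst] if_distribR cong: if_cong)
          (subst sum.cong[OF refl, where h = "\<lambda>k. if k = j then mconst c * mvar j else 0"], auto)
      finally show ?thesis unfolding lin_def by (intro exI)
    qed
    have "lin (\<Sum>m\<in>Poly_Mapping.keys (p i). Poly_Mapping.single m (Poly_Mapping.lookup (p i) m))"
      by (intro sum single deg)
    then show ?thesis by (simp add: lin_def flip: mpoly_sum_monomials)
  qed
  then obtain a c where "\<And>i. p i = (\<Sum>j\<in>UNIV. mconst (a i j) * mvar j) + mconst (c i)" by metis
  then have "p = affine_map (\<chi> i j. a i j) (\<chi> i. c i)" by (auto simp: affine_map_def)
  then show ?thesis by blast
qed

lemma Aff_imp_affine_map:
  fixes \<alpha> :: "('n::finite, 'k::field) poly_map"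
  assumes "\<alpha> \<in> Aff"
  obtains A v where "\<alpha> = affine_map A v" "det A \<noteq> 0"
proof -
  have "mpoly_degree (\<alpha> i) \<le> 1" for i
  proof -
    have "mpoly_degree (\<alpha> i) \<le> Max (range (\<lambda>i. mpoly_degree (\<alpha> i)))" by (rule Max_ge) auto
    also have "\<dots> = 1" using assms unfolding Aff_def by blast
    finally show ?thesis .
  qed
  then obtain A v where "\<alpha> = affine_map A v" using affine_map_eqI by blast
  moreover have "\<alpha> \<in> carrier GA" using assms by (simp add: Aff_def)
  ultimately show ?thesis using that affine_map_in_GA by metis
qed

section \<open>Transvections\<close>

text \<open>The linear map \<open>x \<mapsto> x + x $ i *s u\<close>, a transvection when
  \<open>u $ i = 0\<close>. A whole column is altered at once, so that one step can clear all other
  coordinates of a vector.\<close>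

definition transv :: "'n \<Rightarrow> 'k::comm_ring_1 ^ 'n \<Rightarrow> 'k ^ 'n::finite ^ 'n" where
  "transv i u = (\<chi> r c. mat 1 $ r $ c + (if c = i then u $ r else 0))"

lemma transv_mult_vec: "transv i u *v x = x + x $ i *s u"
proof -
  have "(\<Sum>c\<in>UNIV. (if c = i then u $ r else 0) * x $ c) = x $ i * u $ r" for r
    by (subst sum.cong[OF refl, where h = "\<lambda>c. if c = i then x $ i * u $ r else 0"]) auto
  moreover have "(\<Sum>c\<in>UNIV. mat 1 $ r $ c * x $ c) = x $ r" for r
    by (subst sum.cong[OF refl, where h = "\<lambda>c. if c = r then x $ r else 0"]) (auto simp: mat_def)
  ultimately show ?thesis
    by (simp add: transv_def matrix_vector_mult_def vec_eq_iff distrib_right sum.distrib)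
qed

lemma transv_cancel:
  fixes u :: "'k::field ^ 'n"
  assumes "u $ i = 0"
  shows "transv i (- u) ** (transv i u ** A) = A"
  unfolding matrix_eq
  by (simp add: matrix_vector_mul_assoc[symmetric] transv_mult_vec assms vec_eq_iff)

text \<open>The transpose differs from the identity in row \<open>i\<close> only, and the
  determinant is linear in that row. When \<open>u\<close> is expanded in the standard basis, a term
  with \<open>k \<noteq> i\<close> duplicates row \<open>k\<close>, so only \<open>u $ i\<close>
  survives.\<close>

lemma det_transv: "det (transv i u) = 1 + u $ i"
proof -
  have "transv i u = transpose (\<chi> r. if r = i then row i (mat 1) + u else row r (mat 1))"
    by (simp add: transv_def transpose_def vec_eq_iff row_def mat_def)
  moreover have "det (\<chi> r. if r = i then row i (mat 1) + u else row r (mat 1 :: 'a^'b^'b)) =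
    det (\<chi> r. if r = i then row i (mat 1) else row r (mat 1 :: 'a^'b^'b)) +
    det (\<chi> r. if r = i then u else row r (mat 1 :: 'a^'b^'b))"
    by (rule det_row_add)
  moreover have "(\<chi> r. if r = i then row i (mat 1) else row r (mat 1)) = (mat 1 :: 'a^'b^'b)"
    by (simp add: vec_eq_iff row_def)
  moreover have "det (\<chi> r. if r = i then u else row r (mat 1 :: 'a^'b^'b)) = u $ i"
  proof -
    have *: "det (\<chi> r. if r = i then axis k 1 else row r (mat 1 :: 'a^'b^'b)) = (if k = i then 1 else 0)" for k
    proof (cases "k = i")
      case True
      then have "(\<chi> r. if r = i then axis k 1 else row r (mat 1)) = (mat 1 :: 'a^'b^'b)"
        by (auto simp: vec_eq_iff row_def mat_def axis_def)
      then show ?thesis using True by simp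
    next
      case False
      then show ?thesis
        by (simp, intro det_identical_rows[of i k]) (auto simp: row_def vec_eq_iff axis_def mat_def)
    qed
    have "(\<Sum>k\<in>UNIV. det (\<chi> r. if r = i then u $ k *s axis k 1 else row r (mat 1 :: 'a^'b^'b))) = u $ i"
      by (simp add: det_row_mul * if_distrib[where f = "\<lambda>x. _ * x"] cong: if_cong)
    then have "det (\<chi> r. if r = i then (\<Sum>k\<in>UNIV. u $ k *s axis k 1) else row r (mat 1 :: 'a^'b^'b)) = u $ i"
      by (subst det_linear_row_sum[of UNIV i "\<lambda>_ k. u $ k *s axis k 1"]) simp_all
    then show ?thesis by (simp only: basis_expansion)
  qed
  ultimately show ?thesis by (simp add: det_transpose)
qed

text \<open>
  With a trivial \<open>P\<close> this gives transitivity of \<open>SL\<close> on nonzero vectors; with a general \<open>P\<close> it is the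
  elimination step of the generation of \<open>SL\<close> by transvections.
\<close>

lemma move_vector:
  fixes x :: "'k::field ^ 'n" and P :: "'k ^ 'n ^ 'n \<Rightarrow> bool"
  assumes P: "\<And>A i u. u $ i = 0 \<Longrightarrow> P (transv i u ** A) \<Longrightarrow> P A"
    and ij: "i \<noteq> j" "i \<notin> K" "j \<notin> K" and r: "r \<notin> K" "x $ r \<noteq> 0"
  obtains B where "det B = 1" "B *v x = axis i 1" "\<And>k. k \<in> K \<Longrightarrow> B *v axis k 1 = axis k 1"
    "\<And>A. P (B ** A) \<Longrightarrow> P A"
proof -
  define Q where "Q y \<longleftrightarrow> (\<exists>B. det B = 1 \<and> B *v y = axis i 1 \<and> (\<forall>k\<in>K. B *v axis k 1 = axis k 1) \<and>
    (\<forall>A. P (B ** A) \<longrightarrow> P A))" for y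
  have step: "Q y" if "Q (y + y $ a *s u)" "a \<notin> K" "u $ a = 0" for y a u
  proof -
    obtain B where B: "det B = 1" "B *v (y + y $ a *s u) = axis i 1"
        "\<And>k. k \<in> K \<Longrightarrow> B *v axis k 1 = axis k 1" and PB: "\<And>A. P (B ** A) \<Longrightarrow> P A"
      using \<open>Q (y + y $ a *s u)\<close> by (auto simp: Q_def)
    let ?B = "B ** transv a u"
    have *: "?B *v x = B *v (x + x $ a *s u)" for x
      by (metis matrix_vector_mul_assoc transv_mult_vec)
    have "?B *v axis k 1 = axis k 1" if "k \<in> K" for k
    proof -
      have "axis k 1 $ a = (0 :: 'k)" using that \<open>a \<notin> K\<close> by (auto simp: axis_def)
      then show ?thesis using B(3)[OF that] unfolding * by simp
    qed
    moreover have "P A" if "P (?B ** A)" for A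
      by (rule P[OF \<open>u $ a = 0\<close>], rule PB) (use that in \<open>simp only: matrix_mul_assoc\<close>)
    moreover have "det ?B = 1" using \<open>u $ a = 0\<close> B(1) by (simp add: det_mul det_transv)
    moreover have "?B *v y = axis i 1" unfolding * by (rule B(2))
    ultimately show ?thesis unfolding Q_def by blast
  qed
  have "Q (axis i 1)"
    unfolding Q_def by (rule exI[of _ "mat 1"]) auto
  \<comment> \<open>The moves appear in reverse order: \<open>3\<close> clears all coordinates but
    \<open>i\<close> once that one is \<open>1\<close>; \<open>2\<close> makes coordinate
    \<open>i\<close> equal to \<open>1\<close> by means of a nonzero coordinate \<open>j\<close>;
    the last case makes coordinate \<open>j\<close> nonzero by means of coordinate
    \<open>r\<close>.\<close>
  then have 3: "Q y" if "y $ i = 1" for y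
    using ij that by (intro step[of y i "axis i 1 - y"]) (auto simp: axis_def)
  have 2: "Q y" if "y $ j \<noteq> 0" for y
    using ij that by (intro step[of y j "axis i ((1 - y $ i) / y $ j)"] 3) (auto simp: axis_def)
  have "Q x"
  proof (cases "x $ j = 0")
    case True
    then have "r \<noteq> j" using r by auto
    then show ?thesis using r True by (intro step[of x r "axis j 1"] 2) (auto simp: axis_def)
  qed (rule 2)
  then show ?thesis using that unfolding Q_def by blast
qed

text \<open>Generation of \<open>SL\<close> by transvections, put as an induction rule.
  \<open>K\<close> collects basis vectors that are already fixed, and \<open>move_vector\<close>
  fixes one more as long as two are missing.\<close>

lemma transv_induct:
  fixes A :: "'k::field ^ 'n ^ 'n"
  assumes one: "P (mat 1)"
    and P: "\<And>A i u. u $ i = 0 \<Longrightarrow> P (transv i u ** A) \<Longrightarrow> P A"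
    and A: "det A = 1"
  shows "P A"
proof -
  have "P A" if "det A = 1" "\<And>k. k \<in> K \<Longrightarrow> A *v axis k 1 = axis k 1" for A and K :: "'n set"
    using that
  proof (induction "card (- K)" arbitrary: A K rule: less_induct)
    case less
    note fixK = less.prems(2)
    have "A *v axis k 1 = column k A" for k
      by (simp add: matrix_vector_mult_def axis_def column_def vec_eq_iff if_distrib cong: if_cong)
    then have expand: "A *v x = (\<Sum>k\<in>UNIV. x $ k *s (A *v axis k 1))" for x
      by (simp add: matrix_mult_sum)
    consider "- K = {}" | i where "- K = {i}" | i j where "i \<notin> K" "j \<notin> K" "i \<noteq> j"
      by blast
    then show ?case
    proof cases
      case 1
      then have "A *v x = x" for x
        using fixK unfolding expand[of x] by (simp add: set_eq_iff basis_expansion)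
      then show ?thesis using one by (metis matrix_eq matrix_vector_mul_lid)
    next
      \<comment> \<open>With one basis vector left, \<open>A\<close> has the form
        \<open>transv i u\<close>, and its determinant forces \<open>u $ i = 0\<close>.\<close>
      case (2 i)
      define u where "u = A *v axis i 1 - axis i 1"
      have K: "k \<in> K \<longleftrightarrow> k \<noteq> i" for k using 2 by auto
      have A_axis: "A *v axis k 1 = axis k 1 + (if k = i then u else 0)" for k
        using fixK by (auto simp: K u_def)
      have "A *v x = (\<Sum>k\<in>UNIV. x $ k *s axis k 1) + (\<Sum>k\<in>UNIV. if k = i then x $ i *s u else 0)" for x
        unfolding expand[of x] A_axis sum.distrib[symmetric]
        by (rule sum.cong) (auto simp: vec_eq_iff distrib_left)
      then have "A *v x = transv i u *v x" for x
        by (simp add: basis_expansion transv_mult_vec)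
      then have A: "A = transv i u" by (simp add: matrix_eq)
      then have u: "u $ i = 0" using less.prems(1) by (simp add: det_transv)
      have "P (transv i (- u) ** A)" unfolding A using transv_cancel[OF u, of "mat 1"] one by simp
      then show ?thesis using u by (intro P[of "- u" i A]) simp
    next
      case (3 i j)
      \<comment> \<open>If \<open>A\<close> sent \<open>axis i 1\<close> into the span of the basis
        vectors indexed by \<open>K\<close>, it would fix the image. Injectivity would then give
        \<open>A *v axis i 1 = axis i 1\<close>, although \<open>i \<notin> K\<close>.\<close>
      have "\<exists>r. r \<notin> K \<and> (A *v axis i 1) $ r \<noteq> 0"
      proof (rule ccontr)
        assume "\<not> ?thesis"
        then have 0: "(A *v axis i 1) $ r = 0" if "r \<notin> K" for r using that by auto
        let ?x = "A *v axis i 1"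
        have "A *v ?x = (\<Sum>k\<in>UNIV. ?x $ k *s axis k 1)"
          unfolding expand[of ?x]
        proof (rule sum.cong[OF refl])
          fix k show "?x $ k *s (A *v axis k 1) = ?x $ k *s axis k 1"
            by (cases "k \<in> K") (simp_all add: fixK 0)
        qed
        also have "\<dots> = ?x" by (rule basis_expansion)
        finally have "A *v ?x = A *v axis i 1" .
        moreover obtain A' where "A' ** A = mat 1"
          using less.prems(1) invertible_det_nz[of A] by (auto simp: invertible_def)
        ultimately have "?x = axis i 1"
          by (metis matrix_vector_mul_assoc matrix_vector_mul_lid)
        then show False using 0[OF 3(1)] by (simp add: axis_def)
      qed
      then obtain r where r: "r \<notin> K" "(A *v axis i 1) $ r \<noteq> 0" by blast
      obtain B where B: "det B = 1" "B *v (A *v axis i 1) = axis i 1"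
        "\<And>k. k \<in> K \<Longrightarrow> B *v axis k 1 = axis k 1" "\<And>A. P (B ** A) \<Longrightarrow> P A"
        using move_vector[of P i j K r "A *v axis i 1"] P 3 r by metis
      have "P (B ** A)"
      proof (rule less.hyps)
        show "card (- insert i K) < card (- K)"
          using 3 by (intro psubset_card_mono) auto
        show "det (B ** A) = 1" by (simp add: det_mul B less.prems)
        show "(B ** A) *v axis k 1 = axis k 1" if "k \<in> insert i K" for k
          using that B fixK by (auto simp: matrix_vector_mul_assoc[symmetric])
      qed
      then show ?thesis by (rule B)
    qed
  qed
  from this[of A "{}"] A show ?thesis by simp
qed

section \<open>Locally nilpotent operators\<close>

text \<open>\<open>c = 0\<close> covers derivations and \<open>c = 1\<close> difference operators.
  The product rule makes the elements killed by a power of \<open>T\<close> a subalgebra: in every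
  term of \<open>T (p * q)\<close> the sum of the two nilpotency orders has dropped. This subalgebra
  contains the variables.\<close>

lemma locally_nilpotent:
  fixes T :: "('n::finite, 'k::comm_ring_1) mpoly \<Rightarrow> ('n, 'k) mpoly" and c :: "('n, 'k) mpoly"
  assumes add: "\<And>p q. T (p + q) = T p + T q"
    and mult: "\<And>p q. T (p * q) = T p * q + p * T q + c * (T p * T q)"
    and c: "c = 0 \<or> c = 1"
    and const: "\<And>a. T (mconst a) = 0" and var: "\<And>i. T (T (mvar i)) = 0"
  shows "\<exists>k. (T ^^ k) p = 0"
proof -
  have zero: "T 0 = 0" using const[of 0] by simp
  have addk: "(T ^^ k) (p + q) = (T ^^ k) p + (T ^^ k) q" for k p q
    by (induction k) (simp_all add: add)
  have zerok: "(T ^^ k) 0 = 0" for k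
    by (induction k) (simp_all add: zero)
  have mono: "(T ^^ l) p = 0" if "(T ^^ k) p = 0" "k \<le> l" for k l p
  proof -
    have "(T ^^ l) p = (T ^^ (l - k)) ((T ^^ k) p)"
      using that(2) by (metis add.commute comp_apply funpow_add le_add_diff_inverse)
    then show ?thesis by (simp add: that zerok)
  qed
  have sum: "\<exists>k. (T ^^ k) (p + q) = 0" if p: "\<exists>k. (T ^^ k) p = 0" and q: "\<exists>k. (T ^^ k) q = 0" for p q
  proof -
    obtain k l where "(T ^^ k) p = 0" "(T ^^ l) q = 0" using p q by blast
    then have "(T ^^ (max k l)) (p + q) = 0" by (simp add: addk mono)
    then show ?thesis by blast
  qed
  have prod: "\<exists>m. (T ^^ m) (p * q) = 0" if "(T ^^ k) p = 0" "(T ^^ l) q = 0" for k l p q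
    using that
  proof (induction "k + l" arbitrary: k l p q rule: less_induct)
    case less
    show ?case
    proof (cases "k = 0 \<or> l = 0")
      case True
      then have "p * q = 0" using less.prems by auto
      then show ?thesis by (intro exI[of _ 0]) simp
    next
      case False
      then obtain k' l' where kl: "k = Suc k'" "l = Suc l'" using not0_implies_Suc by blast
      have p: "(T ^^ k') (T p) = 0" and q: "(T ^^ l') (T q) = 0"
        using less.prems by (simp_all add: kl funpow_swap1)
      have "\<exists>m. (T ^^ m) (T p * T q) = 0" using less.hyps[OF _ p q] by (simp add: kl)
      then have "\<exists>m. (T ^^ m) (c * (T p * T q)) = 0" using c by (auto simp: zerok)
      moreover have "\<exists>m. (T ^^ m) (T p * q) = 0" using less.hyps[OF _ p less.prems(2)] by (simp add: kl)
      moreover have "\<exists>m. (T ^^ m) (p * T q) = 0" using less.hyps[OF _ less.prems(1) q] by (simp add: kl)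
      ultimately obtain m where "(T ^^ m) (T (p * q)) = 0" unfolding mult using sum by meson
      then have "(T ^^ Suc m) (p * q) = 0" by (simp add: funpow_swap1)
      then show ?thesis by blast
    qed
  qed
  show ?thesis
  proof (induction p rule: mpoly_induct)
    case (const a)
    have "(T ^^ 1) (mconst a) = 0" using assms(4) by simp
    then show ?case by blast
  next
    case (var i)
    have "(T ^^ Suc (Suc 0)) (mvar i) = 0" using assms(5) by simp
    then show ?case by blast
  next
    case (add p q)
    then show ?case by (rule sum)
  next
    case (mult p q)
    then show ?case using prod by blast
  qed
qed

definition mpoly_diff :: "'k::comm_ring_1 ^ 'n \<Rightarrow> ('n::finite, 'k) mpoly \<Rightarrow> ('n, 'k) mpoly" where
  "mpoly_diff w p = mpoly_subst (transl w) p - p"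

lemma mpoly_diff_nilpotent: "\<exists>k. (mpoly_diff w ^^ k) p = 0"
proof (rule locally_nilpotent[where c = 1])
  show "mpoly_diff w (p * q) = mpoly_diff w p * q + p * mpoly_diff w q + 1 * (mpoly_diff w p * mpoly_diff w q)"
    for p q by (simp add: mpoly_diff_def mpoly_subst_mult algebra_simps)
qed (simp_all add: mpoly_diff_def mpoly_subst_add mpoly_subst_diff transl_def)

lemma mpoly_deriv_nilpotent:
  fixes p :: "('n::finite, 'k::comm_ring_1) mpoly"
  shows "\<exists>k. (mpoly_deriv j ^^ k) p = 0"
proof (rule locally_nilpotent[where c = 0])
  show "mpoly_deriv j (mpoly_deriv j (mvar i)) = (0 :: ('n, 'k) mpoly)" for i
    using mpoly_deriv_mconst[of j "1 :: 'k"] by (simp add: mpoly_deriv_mvar)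
qed (simp_all add: mpoly_deriv_add mpoly_deriv_mult)

text \<open>Distinct monomials involving the variable \<open>j\<close> have derivatives with
  distinct exponents, and characteristic zero keeps the factor coming from the exponent
  nonzero.\<close>

lemma mpoly_deriv_eq_0_iff:
  fixes p :: "('n, 'k::field_char_0) mpoly"
  shows "mpoly_deriv j p = 0 \<longleftrightarrow> j \<notin> mpoly_vars p"
proof
  assume *: "mpoly_deriv j p = 0"
  show "j \<notin> mpoly_vars p"
  proof
    assume "j \<in> mpoly_vars p"
    then obtain m where m: "m \<in> Poly_Mapping.keys p" "Poly_Mapping.lookup m j \<noteq> 0"
      by (auto simp: mpoly_vars_def in_keys_iff)
    let ?e = "Poly_Mapping.single j (1::nat)"
    have inj: "m' = m" if "m' - ?e = m - ?e" "Poly_Mapping.lookup m' j \<noteq> 0" for m'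
    proof (rule poly_mapping_eqI)
      fix i
      have "Poly_Mapping.lookup m' i - Poly_Mapping.lookup ?e i = Poly_Mapping.lookup m i - Poly_Mapping.lookup ?e i"
        using that(1) by (metis lookup_minus)
      then show "Poly_Mapping.lookup m' i = Poly_Mapping.lookup m i"
        using that(2) m(2) by (cases "i = j") (simp_all add: lookup_single)
    qed
    have "0 = Poly_Mapping.lookup (mpoly_deriv j p) (m - ?e)" by (simp add: *)
    also have "\<dots> = (\<Sum>m'\<in>Poly_Mapping.keys p. Poly_Mapping.lookup (Poly_Mapping.single (m' - ?e)
       (of_nat (Poly_Mapping.lookup m' j) * Poly_Mapping.lookup p m')) (m - ?e))"
      by (simp add: mpoly_deriv_def lookup_sum)
    also have "\<dots> = (\<Sum>m'\<in>Poly_Mapping.keys p. if m' = m then of_nat (Poly_Mapping.lookup m j) * Poly_Mapping.lookup p m else 0)"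
    proof (rule sum.cong[OF refl])
      fix m'
      show "Poly_Mapping.lookup (Poly_Mapping.single (m' - ?e)
         (of_nat (Poly_Mapping.lookup m' j) * Poly_Mapping.lookup p m')) (m - ?e) =
        (if m' = m then of_nat (Poly_Mapping.lookup m j) * Poly_Mapping.lookup p m else 0)"
        using inj[of m'] by (cases "Poly_Mapping.lookup m' j = 0") (auto simp: lookup_single when_def)
    qed
    also have "\<dots> = of_nat (Poly_Mapping.lookup m j) * Poly_Mapping.lookup p m"
      using m by simp
    finally show False using m by (simp add: in_keys_iff)
  qed
qed (rule mpoly_deriv_eq_0)

lemma mpoly_deriv_transl:
  "mpoly_deriv j (mpoly_subst (transl w) p) = mpoly_subst (transl w) (mpoly_deriv j p)"
proof -
  have *: "mpoly_deriv j (transl w i) = (if i = j then 1 else 0)" for i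
    by (simp add: transl_def mpoly_deriv_add mpoly_deriv_mvar)
  show ?thesis by (simp add: mpoly_deriv_subst * if_distrib[where f = "\<lambda>x. _ * x"] cong: if_cong)
qed

text \<open>Differentiation commutes with the shift, so all derivatives of \<open>p\<close> are
  invariant. If the variable \<open>j\<close> occurred, some derivative \<open>r\<close> would have
  degree exactly one in it: \<open>r = q + mvar j * ?D r\<close> with \<open>q\<close> and
  \<open>?D r\<close> free of that variable. The shift would then add \<open>?D r \<noteq> 0\<close>
  to \<open>r\<close>.\<close>

lemma shift_invariant_imp_notin_vars:
  fixes p :: "('n::finite, 'k::field_char_0) mpoly"
  assumes inv: "mpoly_subst (transl (axis j 1)) p = p"
  shows "j \<notin> mpoly_vars p"
proof (rule ccontr)
  assume "\<not> j \<notin> mpoly_vars p"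
  let ?D = "mpoly_deriv j" and ?T = "mpoly_subst (transl (axis j 1))"
  have invk: "?T ((?D ^^ k) p) = (?D ^^ k) p" for k
    by (induction k) (simp_all add: inv mpoly_deriv_transl[symmetric])
  define K where "K = (LEAST k. (?D ^^ k) p = 0)"
  have K: "(?D ^^ K) p = 0" unfolding K_def by (rule LeastI_ex) (rule mpoly_deriv_nilpotent)
  have "K \<noteq> 0" using K \<open>\<not> j \<notin> mpoly_vars p\<close> by (intro notI) simp
  moreover have "K \<noteq> 1" using K \<open>\<not> j \<notin> mpoly_vars p\<close> by (intro notI) (simp add: mpoly_deriv_eq_0_iff)
  ultimately obtain k where k: "K = Suc (Suc k)" by (metis One_nat_def not0_implies_Suc)
  define r where "r = (?D ^^ k) p"
  have Dr: "?D r \<noteq> 0"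
    using not_less_Least[of "Suc k" "\<lambda>k. (?D ^^ k) p = 0"] k by (auto simp: K_def r_def)
  have DDr: "?D (?D r) = 0" using K by (simp add: k r_def)
  define q where "q = r - mvar j * ?D r"
  have "?D q = 0" by (simp add: q_def mpoly_deriv_diff mpoly_deriv_mult DDr mpoly_deriv_mvar)
  then have "?T q = q"
    using mpoly_subst_cong[of q "transl (axis j 1)" mvar]
    by (force simp: mpoly_deriv_eq_0_iff transl_def axis_def)
  moreover have "?T (?D r) = ?D r" using invk[of "Suc k"] by (simp add: r_def)
  moreover have "?T r = r" using invk[of k] by (simp add: r_def)
  ultimately have "r - transl (axis j 1) j * ?D r = r - mvar j * ?D r"
    by (simp add: q_def mpoly_subst_diff mpoly_subst_mult)
  then have "?D r = 0" by (simp add: transl_def distrib_right)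
  with Dr show False by simp
qed

section \<open>Shears\<close>

definition shear :: "'n \<Rightarrow> ('n, 'k::comm_ring_1) mpoly \<Rightarrow> ('n, 'k) poly_map" where
  "shear i p = mvar(i := mvar i + p)"

lemma shear_comp:
  assumes "i \<notin> mpoly_vars p"
  shows "poly_map_comp (shear i p) (shear i q) = shear i (p + q)"
proof -
  have "mpoly_subst (shear i q) p = p"
    using mpoly_subst_cong[of p "shear i q" mvar] assms by (force simp: shear_def)
  then show ?thesis
    by (auto simp: poly_map_comp_def mpoly_subst_add shear_def fun_eq_iff)
qed

lemma shear_0 [simp]: "shear i 0 = mvar"
  by (simp add: shear_def)

lemma shear_eq_mvar_iff [simp]: "shear i p = mvar \<longleftrightarrow> p = 0"
  by (auto simp: shear_def fun_eq_iff)

lemma shear_in_SA: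
  assumes "i \<notin> mpoly_vars p"
  shows "shear i p \<in> carrier SA"
proof -
  have "poly_map_comp (shear i (- p)) (shear i p) = mvar" "poly_map_comp (shear i p) (shear i (- p)) = mvar"
    using assms by (simp_all add: shear_comp)
  then have "shear i p \<in> carrier GA" by (auto simp: carrier_GA)
  \<comment> \<open>The \<open>i\<close>-th entry of the gradient vanishes because \<open>p\<close>
    does not involve that variable, so \<open>det_transv\<close> gives \<open>1\<close>.\<close>
  moreover have "jacobian (shear i p) = transpose (transv i (\<chi> c. mpoly_deriv c p))"
    by (auto simp: jacobian_def transpose_def transv_def vec_eq_iff shear_def mat_def
        mpoly_deriv_add mpoly_deriv_mvar)
  ultimately show ?thesis
    using assms by (simp add: SA_def det_transpose det_transv mpoly_deriv_eq_0)
qed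

lemma inv_shear:
  assumes "i \<notin> mpoly_vars p"
  shows "inv\<^bsub>SA\<^esub> (shear i p) = shear i (- p)"
  by (rule group.inv_equality[OF group_SA])
    (use assms in \<open>simp_all add: mult_SA one_SA shear_comp shear_in_SA\<close>)

lemma inv_transl: "inv\<^bsub>SA\<^esub> (transl v) = transl (- v)"
  by (rule group.inv_equality[OF group_SA])
    (simp_all add: mult_SA one_SA transl_comp transl_0)

lemma conj_by_affine_transl:
  fixes A :: "'k::field ^ 'n ^ 'n::finite"
  assumes "det A = 1"
  shows "group.conj_by SA (affine_map A u) (transl v) = transl (A *v v)"
  by (rule group_conj_by_eqI[OF group_SA]) (use assms in \<open>simp_all add: affine_map_in_SA mult_SA affine_map_transl\<close>)

section \<open>Unipotent triangular automorphisms\<close>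

text \<open>The maps in \<open>BA\<close> with all \<open>a i = 1\<close>: the polynomial
  \<open>P i\<close> is recovered as \<open>\<sigma> i - mvar i\<close>, which replaces the
  existential quantifiers.\<close>

definition unitri :: "('n::{finite, linorder}, 'k::field) poly_map set" where
  "unitri = {\<sigma> \<in> carrier GA. \<forall>i. mpoly_vars (\<sigma> i - mvar i) \<subseteq> {..<i}}"

lemma unitriD: "\<sigma> \<in> unitri \<Longrightarrow> mpoly_vars (\<sigma> i - mvar i) \<subseteq> {..<i}"
  by (simp add: unitri_def)

lemma unitri_vars: "\<sigma> \<in> unitri \<Longrightarrow> mpoly_vars (\<sigma> i) \<subseteq> {..i}"
  using mpoly_vars_add[of "mvar i" "\<sigma> i - mvar i"] unitriD[of \<sigma> i] by fastforce

lemma mpoly_vars_subst_lessThan: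
  fixes \<psi> :: "('n::{finite, linorder}, 'k::comm_ring_1) poly_map"
  assumes "mpoly_vars p \<subseteq> {..<i}" "\<And>j. j < i \<Longrightarrow> mpoly_vars (\<psi> j) \<subseteq> {..j}"
  shows "mpoly_vars (mpoly_subst \<psi> p) \<subseteq> {..<i}"
proof
  fix l assume "l \<in> mpoly_vars (mpoly_subst \<psi> p)"
  then obtain j where j: "j \<in> mpoly_vars p" "l \<in> mpoly_vars (\<psi> j)" using mpoly_vars_subst by blast
  then have "j < i" using assms(1) by auto
  then show "l \<in> {..<i}" using j(2) assms(2)[of j] by auto
qed

lemma finite_linorder_induct:
  fixes i :: "'n::{finite, linorder}"
  assumes "\<And>i. (\<And>j. j < i \<Longrightarrow> P j) \<Longrightarrow> P i"
  shows "P i"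
proof (induction "card {..<i}" arbitrary: i rule: less_induct)
  case less
  have "card {..<j} < card {..<i}" if "j < i" for j
    using that by (intro psubset_card_mono) auto
  then show ?case using less by (metis assms)
qed

text \<open>In the Leibniz formula, a permutation other than \<open>id\<close> sends its least
  non-fixed index \<open>m\<close> to a larger one, where row \<open>m\<close> vanishes.\<close>

lemma det_unilower:
  fixes A :: "'a::comm_ring_1 ^ 'n::{finite, linorder} ^ 'n::{finite, linorder}"
  assumes "\<And>i j. i < j \<Longrightarrow> A $ i $ j = 0" "\<And>i. A $ i $ i = 1"
  shows "det A = 1"
proof -
  have "(\<Prod>i\<in>UNIV. A $ i $ p i) = 0" if "p permutes UNIV" "p \<noteq> id" for p
  proof -
    define m where "m = Min {i. p i \<noteq> i}"
    have "{i. p i \<noteq> i} \<noteq> {}" using that(2) by auto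
    then have m: "p m \<noteq> m" using Min_in[of "{i. p i \<noteq> i}"] by (auto simp: m_def)
    have "\<not> p m < m"
    proof
      assume less: "p m < m"
      have "p (p m) = p m"
      proof (rule ccontr)
        assume "p (p m) \<noteq> p m"
        then have "m \<le> p m" unfolding m_def by (intro Min_le) auto
        with less show False by simp
      qed
      then have "p m = m" using permutes_inj[OF that(1)] by (simp add: inj_eq)
      with m show False by simp
    qed
    then have "A $ m $ p m = 0" using m by (intro assms) auto
    then show ?thesis by (intro prod_zero) auto
  qed
  then have "det A = (\<Sum>p\<in>{p :: 'n \<Rightarrow> 'n. p permutes UNIV}. if p = id then 1 else 0)"
    unfolding det_def by (intro sum.cong refl) (use assms(2) in \<open>auto simp: sign_id\<close>)
  also have "\<dots> = 1" by (simp add: permutes_id finite_permutations)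
  finally show ?thesis .
qed

lemma unitri_subset_SA: "unitri \<subseteq> carrier SA"
proof
  fix \<sigma> :: "('n::{finite, linorder}, 'k::field) poly_map" assume \<sigma>: "\<sigma> \<in> unitri"
  have deriv: "mpoly_deriv j (\<sigma> i) = (if i = j then 1 else 0)" if "i \<le> j" for i j
  proof -
    have "mpoly_deriv j (\<sigma> i - mvar i) = 0"
      using unitriD[OF \<sigma>, of i] that by (intro mpoly_deriv_eq_0) auto
    then show ?thesis by (simp add: mpoly_deriv_diff mpoly_deriv_mvar)
  qed
  have "det (jacobian \<sigma>) = 1"
    by (rule det_unilower) (auto simp: jacobian_def deriv)
  then show "\<sigma> \<in> carrier SA" using \<sigma> by (simp add: SA_def unitri_def)
qed

lemma subgroup_unitri: "subgroup unitri SA"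
proof (rule group.subgroupI[OF group_SA unitri_subset_SA])
  have "mvar \<in> unitri" using group.is_monoid[OF group_GA, THEN monoid.one_closed]
    by (simp add: unitri_def one_GA)
  then show "unitri \<noteq> {}" by blast
next
  fix \<sigma> \<psi> :: "('n::{finite, linorder}, 'k::field) poly_map"
  assume \<sigma>: "\<sigma> \<in> unitri" and \<psi>: "\<psi> \<in> unitri"
  show "\<sigma> \<otimes>\<^bsub>SA\<^esub> \<psi> \<in> unitri"
    unfolding unitri_def
  proof (intro CollectI conjI allI)
    have "\<sigma> \<otimes>\<^bsub>SA\<^esub> \<psi> \<in> carrier SA"
      using \<sigma> \<psi> unitri_subset_SA monoid.m_closed[OF group.is_monoid[OF group_SA]] by blast
    then show "\<sigma> \<otimes>\<^bsub>SA\<^esub> \<psi> \<in> carrier GA" by (simp add: SA_def)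
    fix i
    have "(\<sigma> \<otimes>\<^bsub>SA\<^esub> \<psi>) i - mvar i = mpoly_subst \<psi> (\<sigma> i - mvar i) + (\<psi> i - mvar i)"
      by (simp add: mult_SA poly_map_comp_def mpoly_subst_diff)
    also have "mpoly_vars \<dots> \<subseteq> mpoly_vars (mpoly_subst \<psi> (\<sigma> i - mvar i)) \<union> mpoly_vars (\<psi> i - mvar i)"
      by (rule mpoly_vars_add)
    also have "\<dots> \<subseteq> {..<i}"
    proof -
      have "mpoly_vars (mpoly_subst \<psi> (\<sigma> i - mvar i)) \<subseteq> {..<i}"
        by (rule mpoly_vars_subst_lessThan) (use unitriD[OF \<sigma>] unitri_vars[OF \<psi>] in auto)
      then show ?thesis using unitriD[OF \<psi>, of i] by auto
    qed
    finally show "mpoly_vars ((\<sigma> \<otimes>\<^bsub>SA\<^esub> \<psi>) i - mvar i) \<subseteq> {..<i}" .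
  qed
next
  fix \<sigma> :: "('n::{finite, linorder}, 'k::field) poly_map" assume \<sigma>: "\<sigma> \<in> unitri"
  let ?\<chi> = "inv\<^bsub>SA\<^esub> \<sigma>"
  have \<chi>: "?\<chi> \<in> carrier SA" using \<sigma> unitri_subset_SA group.inv_closed[OF group_SA] by blast
  have "poly_map_comp \<sigma> ?\<chi> = mvar"
    using group.r_inv[OF group_SA, of \<sigma>] \<sigma> unitri_subset_SA by (auto simp: mult_SA one_SA)
  then have "mpoly_subst ?\<chi> (\<sigma> i) = mvar i" for i by (simp add: poly_map_comp_def fun_eq_iff)
  \<comment> \<open>A recursion for the inverse: as \<open>\<sigma> i - mvar i\<close> involves only
    smaller variables, only components of \<open>?\<chi>\<close> below \<open>i\<close> enter on the
    right.\<close>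
  then have eq: "?\<chi> i - mvar i = - mpoly_subst ?\<chi> (\<sigma> i - mvar i)" for i
    by (simp add: mpoly_subst_diff)
  have "mpoly_vars (?\<chi> i - mvar i) \<subseteq> {..<i}" for i
  proof (induction i rule: finite_linorder_induct)
    case (1 i)
    have "mpoly_vars (?\<chi> j) \<subseteq> {..j}" if "j < i" for j
      using 1[OF that] mpoly_vars_add[of "mvar j" "?\<chi> j - mvar j"] by fastforce
    then have "mpoly_vars (mpoly_subst ?\<chi> (\<sigma> i - mvar i)) \<subseteq> {..<i}"
      by (intro mpoly_vars_subst_lessThan unitriD[OF \<sigma>])
    then show ?case unfolding eq[of i] by simp
  qed
  then show "?\<chi> \<in> unitri" using \<chi> by (simp add: unitri_def SA_def)
qed

lemma transl_in_unitri: "transl v \<in> unitri"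
  using transl_in_SA[of v] by (simp add: unitri_def SA_def) (simp add: transl_def)

lemma shear_in_unitri:
  assumes "mpoly_vars p \<subseteq> {..<i}"
  shows "shear i p \<in> unitri"
  using shear_in_SA[of i p] assms by (auto simp: unitri_def SA_def shear_def)

lemma transl_comp_apply:
  "poly_map_comp (transl w) \<sigma> i = \<sigma> i + mconst (w $ i)"
  by (simp add: poly_map_comp_def transl_def mpoly_subst_add)

lemma mvar_plus_subst_diff:
  "mpoly_subst \<psi> p = \<psi> i + mpoly_subst \<psi> (p - mvar i)"
  by (simp add: mpoly_subst_diff)

text \<open>Multiplying by \<open>\<sigma>\<close> on the left removes its inverse. What remains is
  an implicit equation for the commutator \<open>\<psi>\<close>, to be solved from the smallest
  variable upwards when \<open>\<sigma>\<close> is triangular.\<close>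

lemma commutator_transl_apply:
  fixes \<sigma> :: "('n::finite, 'k::field) poly_map"
  assumes \<sigma>: "\<sigma> \<in> carrier SA"
    and \<psi>: "\<psi> = inv\<^bsub>SA\<^esub> \<sigma> \<otimes>\<^bsub>SA\<^esub> inv\<^bsub>SA\<^esub> (transl w) \<otimes>\<^bsub>SA\<^esub> \<sigma> \<otimes>\<^bsub>SA\<^esub> transl w"
  shows "\<psi> i + mpoly_subst \<psi> (\<sigma> i - mvar i) = mvar i + mpoly_subst (transl w) (\<sigma> i - mvar i)"
proof -
  interpret group SA by (rule group_SA)
  have "\<sigma> \<otimes>\<^bsub>SA\<^esub> \<psi> = inv\<^bsub>SA\<^esub> (transl w) \<otimes>\<^bsub>SA\<^esub> \<sigma> \<otimes>\<^bsub>SA\<^esub> transl w"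
    using \<sigma> by (simp add: \<psi> m_assoc[symmetric])
  then have "poly_map_comp \<sigma> \<psi> i = poly_map_comp (transl (- w)) (poly_map_comp \<sigma> (transl w)) i"
    using \<sigma> by (simp add: inv_transl m_assoc mult_SA[symmetric])
  then have "mpoly_subst \<psi> (\<sigma> i) = mpoly_subst (transl w) (\<sigma> i) - mconst (w $ i)"
    by (simp add: transl_comp_apply) (simp add: poly_map_comp_def mconst_uminus)
  then show ?thesis
    unfolding mvar_plus_subst_diff[of \<psi> "\<sigma> i" i] mvar_plus_subst_diff[of "transl w" "\<sigma> i" i]
    by (simp add: transl_def)
qed

text \<open>The induction step for arguments that treat the components along initial segments
  \<open>J\<close> of the variables.\<close>

lemma downward_closed_extend:
  fixes J :: "'n::{finite, linorder} set"
  assumes "\<forall>i\<in>J. {..<i} \<subseteq> J" "J \<noteq> UNIV"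
  obtains m where "m \<notin> J" "{..<m} \<subseteq> J" "\<forall>i\<in>insert m J. {..<i} \<subseteq> insert m J"
    "card (- insert m J) < card (- J)"
proof -
  define m where "m = Min (- J)"
  have m: "m \<notin> J" using Min_in[of "- J"] assms(2) by (auto simp: m_def)
  moreover have "{..<m} \<subseteq> J"
  proof
    fix j assume "j \<in> {..<m}"
    moreover have "m \<le> j" if "j \<notin> J" using that by (simp add: m_def)
    ultimately show "j \<in> J" by force
  qed
  moreover have "card (- insert m J) < card (- J)" using m by (intro psubset_card_mono) auto
  moreover have "\<forall>i\<in>insert m J. {..<i} \<subseteq> insert m J" using assms(1) \<open>{..<m} \<subseteq> J\<close> by auto
  ultimately show ?thesis using that by blast
qed

text \<open>Once the components in an initial segment \<open>J\<close> are trivial, taking the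
  commutator with \<open>transl w\<close> acts on \<open>\<sigma> m - mvar m\<close>, for the next
  variable \<open>m\<close>, as the locally nilpotent operator \<open>mpoly_diff w\<close>. So the
  components become trivial one after the other.\<close>

lemma unitri_nilpotent:
  fixes \<sigma> :: "('n::{finite, linorder}, 'k::field) poly_map"
  assumes "\<sigma> \<in> unitri"
  shows "\<exists>k. ((\<lambda>s. inv\<^bsub>SA\<^esub> s \<otimes>\<^bsub>SA\<^esub> inv\<^bsub>SA\<^esub> (transl w) \<otimes>\<^bsub>SA\<^esub> s \<otimes>\<^bsub>SA\<^esub> transl w) ^^ k) \<sigma> = \<one>\<^bsub>SA\<^esub>"
proof -
  define f where "f = (\<lambda>s :: ('n, 'k) poly_map.
    inv\<^bsub>SA\<^esub> s \<otimes>\<^bsub>SA\<^esub> inv\<^bsub>SA\<^esub> (transl w) \<otimes>\<^bsub>SA\<^esub> s \<otimes>\<^bsub>SA\<^esub> transl w)"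
  have f: "f s \<in> unitri" if "s \<in> unitri" for s
    unfolding f_def by (intro subgroup.m_closed[OF subgroup_unitri] subgroup.m_inv_closed[OF subgroup_unitri]
      that transl_in_unitri)
  have f_apply: "f s i + mpoly_subst (f s) (s i - mvar i) = mvar i + mpoly_subst (transl w) (s i - mvar i)"
    if "s \<in> unitri" for s i
    by (rule commutator_transl_apply) (use that unitri_subset_SA in \<open>auto simp: f_def\<close>)
  have "\<exists>k. (f ^^ k) \<sigma> = mvar"
    if "\<forall>i\<in>J. {..<i} \<subseteq> J" "\<sigma> \<in> unitri" "\<And>i. i \<in> J \<Longrightarrow> \<sigma> i = mvar i" for \<sigma> and J :: "'n set"
    using that
  proof (induction "card (- J)" arbitrary: J \<sigma> rule: less_induct)
    case less
    show ?case
    proof (cases "J = UNIV")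
      case True
      then have "(f ^^ 0) \<sigma> = mvar" using less.prems by auto
      then show ?thesis by blast
    next
      case False
      obtain m where m: "m \<notin> J" "{..<m} \<subseteq> J" and down: "\<forall>i\<in>insert m J. {..<i} \<subseteq> insert m J"
        and card: "card (- insert m J) < card (- J)"
        by (rule downward_closed_extend[OF less.prems(1) False])
      have iter: "(f ^^ k) \<sigma> \<in> unitri \<and> (\<forall>i\<in>J. (f ^^ k) \<sigma> i = mvar i) \<and>
        (f ^^ k) \<sigma> m - mvar m = (mpoly_diff w ^^ k) (\<sigma> m - mvar m)" for k
      proof (induction k)
        case 0
        then show ?case using less.prems by simp
      next
        case (Suc k)
        define s where "s = (f ^^ k) \<sigma>"
        have s: "s \<in> unitri" "\<And>i. i \<in> J \<Longrightarrow> s i = mvar i"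
          "s m - mvar m = (mpoly_diff w ^^ k) (\<sigma> m - mvar m)" using Suc by (auto simp: s_def)
        have fs: "f s i = mvar i" if "i \<in> J" for i
          using f_apply[OF s(1), of i] s(2)[OF that] by simp
        \<comment> \<open>Only variables in \<open>J\<close> occur in \<open>s m - mvar m\<close>,
          and there \<open>f s\<close> is trivial.\<close>
        have "mpoly_subst (f s) (s m - mvar m) = mpoly_subst mvar (s m - mvar m)"
          using unitriD[OF s(1), of m] m fs by (intro mpoly_subst_cong) blast
        then have eq: "f s m + (s m - mvar m) = mvar m + mpoly_subst (transl w) (s m - mvar m)"
          using f_apply[OF s(1), of m] by (simp only: mpoly_subst_id)
        have "a - x = t - b" if "a + b = x + t" for a b x t :: "('n, 'k) mpoly"
          using that by (simp add: algebra_simps)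
        from this[OF eq] have "f s m - mvar m = mpoly_diff w (s m - mvar m)"
          by (simp only: mpoly_diff_def)
        then show ?case using f[OF s(1)] fs by (simp add: s(3)) (simp add: s_def)
      qed
      obtain k where k: "(mpoly_diff w ^^ k) (\<sigma> m - mvar m) = 0" using mpoly_diff_nilpotent by blast
      have "\<exists>l. (f ^^ l) ((f ^^ k) \<sigma>) = mvar"
        using iter[of k] k by (intro less.hyps[OF card down]) auto
      then show ?thesis by (metis comp_apply funpow_add)
    qed
  qed
  from this[of "{}" \<sigma>] assms show ?thesis by (simp add: one_SA f_def)
qed

section \<open>Normal subgroups\<close>

text \<open>For each variable in turn, \<open>\<sigma>\<close> is replaced by the last nontrivial
  one among its iterated commutators with the unit translation; this one commutes with that
  translation. Earlier relations survive because translations commute with each other. An element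
  commuting with all unit translations has constant differences
  \<open>\<sigma> i - mvar i\<close>.\<close>

lemma normal_unitri_imp_transl:
  fixes N :: "('n::{finite, linorder}, 'k::field_char_0) poly_map set"
  assumes N: "N \<lhd> SA" and \<sigma>: "\<sigma> \<in> N" "\<sigma> \<in> unitri" "\<sigma> \<noteq> mvar"
  obtains v where "transl v \<in> N" "v \<noteq> 0"
proof -
  interpret normal N SA by fact
  have NU: "\<sigma> \<in> carrier SA" if "\<sigma> \<in> unitri" for \<sigma> :: "('n, 'k) poly_map"
    using that unitri_subset_SA by blast
  have "\<exists>\<sigma>. \<sigma> \<in> N \<and> \<sigma> \<in> unitri \<and> \<sigma> \<noteq> mvar \<and> (\<forall>j\<in>J. conj_by (transl (axis j 1)) \<sigma> = \<sigma>)" for J :: "'n set"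
    using finite[of J]
  proof (induction J rule: finite_induct)
    case empty
    then show ?case using \<sigma> by blast
  next
    case (insert j J)
    then obtain \<sigma> where \<sigma>: "\<sigma> \<in> N" "\<sigma> \<in> unitri" "\<sigma> \<noteq> mvar"
      and J: "\<And>k. k \<in> J \<Longrightarrow> conj_by (transl (axis k 1)) \<sigma> = \<sigma>" by blast
    define t :: "('n, 'k) poly_map" where "t = transl (axis j 1)"
    have t: "t \<in> carrier SA" "t \<in> unitri" by (simp_all add: t_def transl_in_unitri)
    let ?f = "\<lambda>s. inv\<^bsub>SA\<^esub> s \<otimes>\<^bsub>SA\<^esub> inv\<^bsub>SA\<^esub> t \<otimes>\<^bsub>SA\<^esub> s \<otimes>\<^bsub>SA\<^esub> t"
    have iter: "(?f ^^ k) \<sigma> \<in> N \<and> (?f ^^ k) \<sigma> \<in> unitri \<and> (\<forall>i\<in>J. conj_by (transl (axis i 1)) ((?f ^^ k) \<sigma>) = (?f ^^ k) \<sigma>)" for k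
    proof (induction k)
      case 0
      then show ?case using \<sigma> J by simp
    next
      case (Suc k)
      define s where "s = (?f ^^ k) \<sigma>"
      have s: "s \<in> N" "s \<in> unitri" "s \<in> carrier SA" "\<And>i. i \<in> J \<Longrightarrow> conj_by (transl (axis i 1)) s = s"
        using Suc NU by (auto simp: s_def)
      have "?f s = inv\<^bsub>SA\<^esub> s \<otimes>\<^bsub>SA\<^esub> conj_by (inv\<^bsub>SA\<^esub> t) s"
        using s t by (simp add: conj_by_def m_assoc)
      also have "\<dots> \<in> N" using s t by (intro subgroup.m_closed[OF subgroup_axioms] m_inv_closed conj_by_mem) auto
      finally have "?f s \<in> N" .
      moreover have "?f s \<in> unitri"
        by (intro subgroup.m_closed[OF subgroup_unitri] subgroup.m_inv_closed[OF subgroup_unitri] s t)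
      moreover have "conj_by (transl (axis i 1)) (?f s) = ?f s" if "i \<in> J" for i
      proof -
        have "conj_by (transl (axis i 1)) t = t"
          unfolding t_def by (rule group_conj_by_eqI[OF group_SA]) (simp_all add: mult_SA transl_comp add.commute)
        then show ?thesis using s t that by (simp add: conj_by_mult conj_by_inv)
      qed
      ultimately show ?case by (simp add: s_def)
    qed
    define K where "K = (LEAST k. (?f ^^ k) \<sigma> = mvar)"
    have K: "(?f ^^ K) \<sigma> = mvar"
      unfolding K_def by (rule LeastI_ex) (use unitri_nilpotent[OF \<sigma>(2), of "axis j 1"] in \<open>simp add: t_def one_SA\<close>)
    have "K \<noteq> 0" using K \<sigma> by (intro notI) simp
    then obtain k where k: "K = Suc k" using not0_implies_Suc by blast
    define s where "s = (?f ^^ k) \<sigma>"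
    have s: "s \<in> N" "s \<in> unitri" "s \<in> carrier SA" "\<And>i. i \<in> J \<Longrightarrow> conj_by (transl (axis i 1)) s = s"
      using iter[of k] NU by (auto simp: s_def)
    have "s \<noteq> mvar" using not_less_Least[of k "\<lambda>k. (?f ^^ k) \<sigma> = mvar"] by (simp add: s_def k K_def[symmetric])
    \<comment> \<open>Triviality of the next commutator says exactly that \<open>s\<close> commutes
      with \<open>t\<close>.\<close>
    moreover have "conj_by t s = s"
    proof -
      have "inv\<^bsub>SA\<^esub> s \<otimes>\<^bsub>SA\<^esub> conj_by (inv\<^bsub>SA\<^esub> t) s = \<one>\<^bsub>SA\<^esub>"
        using K s t by (simp add: k s_def[symmetric] one_SA conj_by_def m_assoc)
      then have "conj_by (inv\<^bsub>SA\<^esub> t) s = s"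
        using s t by (metis conj_by_closed inv_closed inv_equality inv_inv)
      then show ?thesis using s t by (metis conj_by_inv_conj_by(2))
    qed
    ultimately show ?case using s by (auto simp: t_def)
  qed
  from this[of UNIV] obtain \<sigma> where \<sigma>: "\<sigma> \<in> N" "\<sigma> \<in> unitri" "\<sigma> \<noteq> mvar"
    and comm: "\<And>j. conj_by (transl (axis j 1)) \<sigma> = \<sigma>" by blast
  have "\<exists>c. \<sigma> i - mvar i = mconst c" for i
  proof (rule mpoly_vars_empty_imp_mconst)
    have "j \<notin> mpoly_vars (\<sigma> i - mvar i)" for j
    proof (rule shift_invariant_imp_notin_vars)
      have "transl (axis j 1) \<otimes>\<^bsub>SA\<^esub> \<sigma> = \<sigma> \<otimes>\<^bsub>SA\<^esub> transl (axis j 1)"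
        using comm[of j] NU[OF \<sigma>(2)] by (simp add: conj_by_eq_self_iff)
      then have "poly_map_comp (transl (axis j 1)) \<sigma> i = poly_map_comp \<sigma> (transl (axis j 1)) i"
        by (simp add: mult_SA)
      then have "mpoly_subst (transl (axis j 1)) (\<sigma> i) = \<sigma> i + mconst (axis j 1 $ i)"
        by (simp add: transl_comp_apply) (simp add: poly_map_comp_def)
      then show "mpoly_subst (transl (axis j 1)) (\<sigma> i - mvar i) = \<sigma> i - mvar i"
        by (simp add: mpoly_subst_diff transl_apply)
    qed
    then show "mpoly_vars (\<sigma> i - mvar i) = {}" by blast
  qed
  then obtain c where "\<And>i. \<sigma> i - mvar i = mconst (c i)" by metis
  then have "\<sigma> = transl (\<chi> i. c i)" by (auto simp: transl_def fun_eq_iff diff_eq_eq add.commute)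
  then show ?thesis using \<sigma> that by (metis transl_0)
qed

lemma exists_ne:
  assumes "CARD('n::finite) \<ge> 2"
  obtains j where "j \<noteq> (i :: 'n)"
proof -
  have "UNIV \<noteq> {i}" using assms by (metis One_nat_def card.empty card.insert empty_iff finite.emptyI
        not_less_eq_eq numeral_2_eq_2 order_refl)
  then show ?thesis using that by blast
qed

lemma SL_vector_to_axis:
  fixes v :: "'k::field ^ 'n"
  assumes "CARD('n) \<ge> 2" "v \<noteq> 0"
  obtains B where "det B = 1" "B *v v = axis i 1"
proof -
  obtain j where "j \<noteq> i" using exists_ne[OF assms(1)] by blast
  moreover obtain r where "v $ r \<noteq> 0" using assms(2) by (auto simp: vec_eq_iff)
  ultimately show ?thesis
    using move_vector[of "\<lambda>_. True" i j "{}" r v] that by auto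
qed

lemma shear_comp_poly_map:
  "poly_map_comp (shear i p) \<phi> = \<phi>(i := \<phi> i + mpoly_subst \<phi> p)"
  by (auto simp: poly_map_comp_def shear_def mpoly_subst_add)

lemma normal_rigid:
  fixes N :: "('n::{finite, linorder}, 'k::field_char_0) poly_map set"
  assumes card: "CARD('n) \<ge> 2" and N: "N \<lhd> SA" and no_transl: "\<And>v. transl v \<in> N \<Longrightarrow> v = 0"
    and X: "X \<in> N" and v: "v \<noteq> 0" and Xv: "group.conj_by SA X (transl v) = transl w"
  shows "X = mvar"
proof -
  interpret normal N SA by fact
  have Xc: "X \<in> carrier SA" using X by (rule mem_carrier)
  \<comment> \<open>This translation is the commutator of \<open>X\<close> with
    \<open>transl v\<close>, so it must be trivial.\<close>
  have "transl (w - v) \<in> N"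
    using commutator_mem[OF X, of "transl v"] by (simp add: Xv inv_transl mult_SA transl_comp)
  then have "w = v" using no_transl by force
  define i :: 'n where "i = Max UNIV"
  have top: "k \<le> i" for k by (simp add: i_def)
  obtain B where B: "det B = 1" "B *v v = axis i 1" using SL_vector_to_axis[OF card v] by blast
  define g where "g = affine_map B 0"
  have g: "g \<in> carrier SA" by (simp add: g_def affine_map_in_SA B)
  define Y where "Y = conj_by g X"
  have Y: "Y \<in> N" "Y \<in> carrier SA" using g X Xc by (auto simp: Y_def conj_by_mem)
  define t :: "('n, 'k) poly_map" where "t = transl (axis i 1)"
  have t: "t \<in> carrier SA" by (simp add: t_def)
  have gv: "conj_by g (transl v) = t" by (simp add: g_def conj_by_affine_transl B t_def)
  then have "conj_by (inv\<^bsub>SA\<^esub> g) t = transl v" using g by (metis conj_by_inv_conj_by(1) transl_in_SA)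
  then have "conj_by Y t = t" using g Xc t Xv \<open>w = v\<close> by (simp add: Y_def conj_by_of_conj_by gv)
  then have "Y \<otimes>\<^bsub>SA\<^esub> t = t \<otimes>\<^bsub>SA\<^esub> Y" using Y t by (simp add: conj_by_eq_self_iff)
  then have Yt: "mpoly_subst t (Y k) = Y k + mconst (axis i 1 $ k)" for k
    unfolding mult_SA t_def fun_eq_iff transl_comp_apply by (simp add: poly_map_comp_def)
  have "mpoly_subst t (Y k - mvar k) = Y k - mvar k" for k
    by (simp add: mpoly_subst_diff Yt) (simp add: t_def transl_def)
  then have "i \<notin> mpoly_vars (Y k - mvar k)" for k
    unfolding t_def by (intro shift_invariant_imp_notin_vars)
  \<comment> \<open>As \<open>i\<close> is the largest variable, not involving it means involving
    only smaller ones.\<close>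
  moreover have "{..<i} = - {i}" using top by (auto simp: less_le)
  ultimately have vars: "mpoly_vars (Y k - mvar k) \<subseteq> {..<i}" for k
    by blast
  have unitri_trivial: "\<sigma> = mvar" if "\<sigma> \<in> N" "\<sigma> \<in> unitri" for \<sigma>
    using normal_unitri_imp_transl[OF N that] no_transl by blast
  have Yk: "Y k = mvar k" if "k \<noteq> i" for k
  proof -
    \<comment> \<open>\<open>Y\<close> intertwines the shears of the last variable by
      \<open>Y k\<close> and by \<open>mvar k\<close>. Their quotient, the shear by
      \<open>Y k - mvar k\<close>, is therefore a commutator in \<open>N\<close>, and it is
      unipotent triangular.\<close>
    define S :: "('n, 'k) poly_map" where "S = shear i (mvar k)"
    have S: "S \<in> carrier SA" using that by (auto simp: S_def intro: shear_in_SA)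
    have "mpoly_vars (Y k) \<subseteq> {..<i}"
      using vars[of k] that top[of k] mpoly_vars_add[of "mvar k" "Y k - mvar k"] by fastforce
    then have S': "shear i (Y k) \<in> carrier SA" by (intro shear_in_SA) auto
    have *: "mpoly_subst (shear i (Y k)) (Y l - mvar l) = Y l - mvar l" for l
      using mpoly_subst_cong[of "Y l - mvar l" "shear i (Y k)" mvar] vars[of l] by (force simp: shear_def)
    have "mpoly_subst (shear i (Y k)) (Y l) = Y l + (shear i (Y k) l - mvar l)" for l
      using *[of l] by (simp add: mpoly_subst_diff algebra_simps)
    then have "poly_map_comp S Y l = poly_map_comp Y (shear i (Y k)) l" for l
      unfolding S_def shear_comp_poly_map by (simp add: poly_map_comp_def) (simp add: shear_def)
    then have "Y \<otimes>\<^bsub>SA\<^esub> shear i (Y k) = S \<otimes>\<^bsub>SA\<^esub> Y" by (auto simp: mult_SA)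
    then have "conj_by (inv\<^bsub>SA\<^esub> Y) S = shear i (Y k)"
      by (rule group_conj_by_eqI(2)[OF group_SA Y(2) S' S])
    then have "shear i (Y k) \<otimes>\<^bsub>SA\<^esub> inv\<^bsub>SA\<^esub> S \<in> N"
      using commutator_mem[of "inv\<^bsub>SA\<^esub> Y" S] Y S by simp
    moreover have "shear i (Y k) \<otimes>\<^bsub>SA\<^esub> inv\<^bsub>SA\<^esub> S = shear i (Y k - mvar k)"
      unfolding S_def using that \<open>mpoly_vars (Y k) \<subseteq> {..<i}\<close>
      by (subst inv_shear) (auto simp: mult_SA intro!: shear_comp[THEN trans])
    ultimately have "shear i (Y k - mvar k) = mvar"
      by (intro unitri_trivial shear_in_unitri vars) simp
    then show ?thesis by simp
  qed
  \<comment> \<open>Only component \<open>i\<close> can still be nontrivial, which makes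
    \<open>Y\<close> itself unipotent triangular.\<close>
  have "mpoly_vars (Y k - mvar k) \<subseteq> {..<k}" for k
    using vars[of k] Yk[of k] by (cases "k = i") auto
  then have "Y \<in> unitri" using Y by (simp add: unitri_def SA_def)
  then have "Y = mvar" using Y by (intro unitri_trivial)
  then show ?thesis using g Xc conj_by_eq_one_iff[of g X] by (simp add: Y_def one_SA)
qed

section \<open>From one translation to all of \<open>SL\<close>\<close>

lemma vec_axis_induct:
  fixes u :: "'k::ring_1 ^ 'n"
  assumes "P 0" "\<And>x y. P x \<Longrightarrow> P y \<Longrightarrow> P (x + y)" "\<And>j. P (axis j (u $ j))"
  shows "P u"
proof -
  have "P (\<Sum>j\<in>J. axis j (u $ j))" for J
    by (induction J rule: infinite_finite_induct) (simp_all add: assms)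
  moreover have "(\<Sum>j\<in>UNIV. axis j (u $ j)) = u"
    using basis_expansion[of u] by (simp add: axis_def vector_scalar_mult_def if_distrib[where f = "\<lambda>x. _ * x"] cong: if_cong)
  ultimately show ?thesis by metis
qed

text \<open>Conjugation by a linear map moves the vector of a translation, and \<open>SL\<close> is
  transitive on nonzero vectors: both translations are carried to the same axis.\<close>

lemma normal_transl_all:
  fixes N :: "('n::finite, 'k::field) poly_map set"
  assumes card: "CARD('n) \<ge> 2" and N: "N \<lhd> SA" and v: "transl v \<in> N" "v \<noteq> 0"
  shows "transl w \<in> N"
proof (cases "w = 0")
  case True
  then show ?thesis using subgroup.one_closed[OF normal_imp_subgroup[OF N]] by (simp add: one_SA transl_0)
next
  case False
  interpret normal N SA by fact
  fix i :: 'n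
  obtain B where B: "det B = 1" "B *v v = axis i 1" using SL_vector_to_axis[OF card v(2)] by blast
  obtain C where C: "det C = 1" "C *v w = axis i 1" using SL_vector_to_axis[OF card False] by blast
  have "conj_by (affine_map B 0) (transl v) \<in> N" using v by (simp add: conj_by_mem affine_map_in_SA B)
  then have "conj_by (affine_map C 0) (transl w) \<in> N" by (simp add: conj_by_affine_transl B C)
  then show ?thesis by (simp add: conj_by_mem_iff affine_map_in_SA C)
qed

text \<open>Conjugation by the translation shifts the argument of \<open>p\<close>, so the
  commutator of the two maps is the shear by the difference.\<close>

lemma normal_shear_diff:
  fixes N :: "('n::finite, 'k::field) poly_map set"
  assumes N: "N \<lhd> SA" and w: "transl w \<in> N" and p: "i \<notin> mpoly_vars p"
  shows "shear i (mpoly_diff w p) \<in> N"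
proof -
  interpret normal N SA by fact
  let ?q = "mpoly_subst (transl w) p"
  have "mpoly_vars (transl w k) \<subseteq> {k}" for k
    using mpoly_vars_add[of "mvar k" "mconst (w $ k)"] by (simp add: transl_def)
  then have q: "i \<notin> mpoly_vars ?q" using mpoly_vars_subst[of "transl w" p] p by blast
  have S: "shear i p \<in> carrier SA" "shear i ?q \<in> carrier SA" using p q by (simp_all add: shear_in_SA)
  have "poly_map_comp (transl w) (shear i ?q) = poly_map_comp (shear i p) (transl w)"
    unfolding shear_comp_poly_map by (rule ext) (auto simp: transl_comp_apply shear_def transl_apply)
  then have "conj_by (inv\<^bsub>SA\<^esub> (transl w)) (shear i p) = shear i ?q"
    by (intro group_conj_by_eqI(2)[OF group_SA]) (simp_all add: S mult_SA)
  then have "shear i ?q \<otimes>\<^bsub>SA\<^esub> inv\<^bsub>SA\<^esub> (shear i p) \<in> N"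
    using commutator_mem[of "inv\<^bsub>SA\<^esub> (transl w)" "shear i p"] w S by simp
  then show ?thesis
    using p q by (simp add: inv_shear mult_SA shear_comp mpoly_diff_def)
qed

lemma linear_transv_apply:
  "linear_poly_map (transv i u) k = mvar k + mconst (u $ k) * mvar i"
proof -
  have "linear_poly_map (transv i u) k =
      linear_poly_map (mat 1) k + (\<Sum>l\<in>UNIV. mconst (if l = i then u $ k else 0) * mvar l)"
    by (simp add: linear_poly_map_def transv_def mconst_add distrib_right sum.distrib)
  also have "(\<Sum>l\<in>UNIV. mconst (if l = i then u $ k else 0) * mvar l) =
      (\<Sum>l\<in>UNIV. if l = i then mconst (u $ k) * mvar i else 0)"
    by (rule sum.cong) auto
  finally show ?thesis by (simp add: linear_poly_map_id)
qed

lemma transv_add: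
  fixes u w :: "'k::field ^ 'n"
  assumes "w $ i = 0"
  shows "transv i (u + w) = transv i u ** transv i w"
  unfolding matrix_eq
  by (simp add: matrix_vector_mul_assoc[symmetric] transv_mult_vec assms vec_eq_iff distrib_left)

lemma linear_in_SA: "det A = 1 \<Longrightarrow> linear_poly_map A \<in> carrier SA"
  by (simp add: linear_eq_affine_map affine_map_in_SA)

text \<open>Commutators of quadratic shears with translations are shears by polynomials of degree
  one. Removing the constants by translations leaves the elementary matrices, whose products are the
  \<open>transv i u\<close> with \<open>u $ i = 0\<close>, and \<open>transv_induct\<close>
  concludes.\<close>

lemma normal_transl_imp_SL:
  fixes N :: "('n::finite, 'k::field_char_0) poly_map set"
  assumes N: "N \<lhd> SA" and transl: "\<And>v. transl v \<in> N"
  shows "SL \<subseteq> N"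
proof -
  interpret normal N SA by fact
  have NS: "subgroup N SA" by (rule subgroup_axioms)
  have lin_shear: "shear j (mconst a * mvar i) \<in> N" if "i \<noteq> j" for i j and a :: 'k
  proof -
    \<comment> \<open>The difference of this square along \<open>axis i 1\<close> is
      \<open>a\<close> times the variable \<open>i\<close> plus the constant \<open>a / 2\<close>,
      which a translation along \<open>j\<close> then cancels.\<close>
    define p :: "('n, 'k) mpoly" where "p = mconst (a / 2) * (mvar i * mvar i)"
    have vars: "mpoly_vars p \<subseteq> {i}"
      using mpoly_vars_mult[of "mconst (a / 2)" "mvar i * mvar i :: ('n, 'k) mpoly"]
        mpoly_vars_mult[of "mvar i" "mvar i :: ('n, 'k) mpoly"] by (auto simp: p_def)
    have "mconst (a / 2) + mconst (a / 2) = (mconst a :: ('n, 'k) mpoly)"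
      by (simp flip: mconst_add)
    then have "mconst a * mvar i = mconst (a / 2) * mvar i + mconst (a / 2) * (mvar i :: ('n, 'k) mpoly)"
      by (metis distrib_right)
    then have diff: "mpoly_diff (axis i 1) p = mconst a * mvar i + mconst (a / 2)"
      by (simp add: mpoly_diff_def p_def mpoly_subst_mult) (simp add: transl_def algebra_simps)
    have "shear j (mpoly_diff (axis i 1) p) \<in> N"
      using vars that by (intro normal_shear_diff N transl) auto
    moreover have "j \<notin> mpoly_vars (mpoly_diff (axis i 1) p)"
      using mpoly_vars_add[of "mconst a * mvar i" "mconst (a / 2) :: ('n, 'k) mpoly"]
        mpoly_vars_mult[of "mconst a" "mvar i :: ('n, 'k) mpoly"] that unfolding diff by auto
    moreover have "transl (axis j (- (a / 2))) = shear j (mconst (- (a / 2)))"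
      by (auto simp: transl_def shear_def axis_def fun_eq_iff)
    ultimately have "shear j (mpoly_diff (axis i 1) p + mconst (- (a / 2))) \<in> N"
      using subgroup.m_closed[OF NS, of "shear j (mpoly_diff (axis i 1) p)" "transl (axis j (- (a / 2)))"]
        transl[of "axis j (- (a / 2))"] by (simp add: mult_SA shear_comp)
    then show ?thesis by (simp add: diff mconst_uminus)
  qed
  have zero: "linear_poly_map (transv i (0 :: 'k ^ 'n)) \<in> N" for i
  proof -
    have "linear_poly_map (transv i 0) = (mvar :: ('n, 'k) poly_map)"
      by (rule ext) (simp add: linear_transv_apply)
    then show ?thesis using subgroup.one_closed[OF NS] by (simp add: one_SA)
  qed
  have transv: "linear_poly_map (transv i u) \<in> N" if "u $ i = 0" for i and u :: "'k ^ 'n"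
  proof -
    have "u $ i = 0 \<longrightarrow> u $ i = 0 \<and> linear_poly_map (transv i u) \<in> N"
    proof (rule vec_axis_induct[of "\<lambda>x. u $ i = 0 \<longrightarrow> x $ i = 0 \<and> linear_poly_map (transv i x) \<in> N"])
      show "u $ i = 0 \<longrightarrow> (0 :: 'k ^ 'n) $ i = 0 \<and> linear_poly_map (transv i (0 :: 'k ^ 'n)) \<in> N"
        using zero by simp
    next
      fix x y :: "'k ^ 'n"
      assume "u $ i = 0 \<longrightarrow> x $ i = 0 \<and> linear_poly_map (transv i x) \<in> N"
        "u $ i = 0 \<longrightarrow> y $ i = 0 \<and> linear_poly_map (transv i y) \<in> N"
      then show "u $ i = 0 \<longrightarrow> (x + y) $ i = 0 \<and> linear_poly_map (transv i (x + y)) \<in> N"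
        using subgroup.m_closed[OF NS, of "linear_poly_map (transv i x)" "linear_poly_map (transv i y)"]
        by (simp add: mult_SA poly_map_comp_linear transv_add)
    next
      fix j
      have "linear_poly_map (transv i (axis j (u $ j))) = shear j (mconst (u $ j) * mvar i)"
        by (rule ext) (simp add: linear_transv_apply shear_def axis_def)
      then show "u $ i = 0 \<longrightarrow> axis j (u $ j) $ i = 0 \<and> linear_poly_map (transv i (axis j (u $ j))) \<in> N"
        using lin_shear[of i j "u $ j"] zero[of i]
        by (cases "i = j") (auto simp: axis_def zero_vec_def)
    qed
    then show ?thesis using that by blast
  qed
  have "linear_poly_map A \<in> N" if "det A = 1" for A :: "'k ^ 'n ^ 'n"
  proof -
    have "det A = 1 \<longrightarrow> linear_poly_map A \<in> N"
    proof (rule transv_induct[of "\<lambda>A. det A = 1 \<longrightarrow> linear_poly_map A \<in> N"])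
      show "det (mat 1 :: 'k ^ 'n ^ 'n) = 1 \<longrightarrow> linear_poly_map (mat 1 :: 'k ^ 'n ^ 'n) \<in> N"
        using subgroup.one_closed[OF NS] by (simp add: linear_poly_map_id one_SA)
    next
      fix A :: "'k ^ 'n ^ 'n" and i and u :: "'k ^ 'n"
      assume u: "u $ i = 0" and *: "det (transv i u ** A) = 1 \<longrightarrow> linear_poly_map (transv i u ** A) \<in> N"
      show "det A = 1 \<longrightarrow> linear_poly_map A \<in> N"
      proof
        assume "det A = 1"
        then have "linear_poly_map (transv i u ** A) \<in> N" using * u by (simp add: det_mul det_transv)
        moreover have "linear_poly_map (transv i (- u)) \<in> N" using u by (intro transv) simp
        ultimately have "linear_poly_map (transv i (- u)) \<otimes>\<^bsub>SA\<^esub> linear_poly_map (transv i u ** A) \<in> N"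
          by (intro subgroup.m_closed[OF NS])
        then show "linear_poly_map A \<in> N"
          by (simp only: mult_SA poly_map_comp_linear transv_cancel[OF u])
      qed
    qed (rule that)
    then show ?thesis using that by blast
  qed
  then show ?thesis by (auto simp: SL_def)
qed

section \<open>From \<open>SL\<close> to affine and triangular maps\<close>

text \<open>The commutator of the transvection \<open>transv i u\<close> with the translation along
  \<open>axis i 1\<close> is the translation by \<open>u\<close>. One nontrivial translation yields
  all of them, and these combine with the linear parts.\<close>

lemma normal_SL_imp_affine:
  fixes N :: "('n::finite, 'k::field) poly_map set"
  assumes card: "CARD('n) \<ge> 2" and N: "N \<lhd> SA" and SL: "SL \<subseteq> N" and A: "det A = 1"
  shows "affine_map A v \<in> N"
proof -
  interpret normal N SA by fact
  fix i :: 'n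
  obtain j where "j \<noteq> i" using exists_ne[OF card] by blast
  define u :: "'k ^ 'n" where "u = axis j 1"
  have u: "u $ i = 0" "u \<noteq> 0" using \<open>j \<noteq> i\<close> by (simp_all add: u_def axis_def vec_eq_iff)
  let ?g = "linear_poly_map (transv i u)" and ?t = "transl (axis i 1)"
  have "?g \<in> SL" using u by (auto simp: SL_def det_transv)
  then have "conj_by ?g ?t \<otimes>\<^bsub>SA\<^esub> inv\<^bsub>SA\<^esub> ?t \<in> N" using SL by (intro commutator_mem) auto
  moreover have "conj_by ?g ?t = transl (axis i 1 + u)"
    using u by (simp add: linear_eq_affine_map conj_by_affine_transl det_transv transv_mult_vec)
  ultimately have "transl u \<in> N" by (simp add: inv_transl mult_SA transl_comp)
  then have "transl v \<in> N" using normal_transl_all[OF card N] u by blast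
  moreover have "linear_poly_map A \<in> N" using SL A by (auto simp: SL_def)
  ultimately have "transl v \<otimes>\<^bsub>SA\<^esub> linear_poly_map A \<in> N" by (rule subgroup.m_closed[OF subgroup_axioms])
  then show ?thesis by (simp add: mult_SA transl_eq_affine_map linear_eq_affine_map affine_map_comp)
qed

definition diag :: "('n \<Rightarrow> 'k::comm_ring_1) \<Rightarrow> 'k ^ 'n ^ 'n::finite" where
  "diag d = (\<chi> r c. if r = c then d r else 0)"

lemma det_diag: "det (diag d) = prod d UNIV"
  unfolding diag_def by (subst det_diagonal) auto

lemma linear_diag_apply: "linear_poly_map (diag d) i = mconst (d i) * mvar i"
proof -
  have "linear_poly_map (diag d) i = (\<Sum>j\<in>UNIV. if j = i then mconst (d i) * mvar i else 0)"
    unfolding linear_poly_map_def by (rule sum.cong) (auto simp: diag_def)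
  then show ?thesis by simp
qed

lemma diag_mult: "diag d ** diag e = diag (\<lambda>i. d i * e i)"
  by (simp add: diag_def matrix_matrix_mult_def vec_eq_iff if_distrib[where f = "\<lambda>x. _ * x"]
      if_distrib[where f = "\<lambda>x. x * _"] cong: if_cong)

lemma diag_1: "diag (\<lambda>_. 1) = mat 1"
  by (simp add: diag_def mat_def)

text \<open>
  Conjugating by the torus element with entries \<open>2\<close> at \<open>i\<close> and \<open>1/2\<close> at \<open>j\<close> multiplies a monomial
  not involving \<open>x\<^sub>i\<close> by a negative power of \<open>2\<close>, never by \<open>1\<close>.
\<close>

lemma normal_SL_imp_shear:
  fixes N :: "('n::finite, 'k::field_char_0) poly_map set"
  assumes card: "CARD('n) \<ge> 2" and N: "N \<lhd> SA" and SL: "SL \<subseteq> N" and p: "i \<notin> mpoly_vars p"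
  shows "shear i p \<in> N"
proof -
  interpret normal N SA by fact
  have NS: "subgroup N SA" by (rule subgroup_axioms)
  obtain j where ji: "j \<noteq> i" using exists_ne[OF card] by blast
  define d :: "'n \<Rightarrow> 'k" where "d = (\<lambda>k. if k = i then 2 else if k = j then 1 / 2 else 1)"
  have "prod d UNIV = d i * (d j * prod d (UNIV - {i} - {j}))"
    using ji by (simp add: prod.remove[of UNIV i] prod.remove[of "UNIV - {i}" j])
  also have "prod d (UNIV - {i} - {j}) = 1" by (rule prod.neutral) (auto simp: d_def)
  finally have det: "det (diag d) = 1" using ji by (simp add: det_diag d_def)
  let ?D = "linear_poly_map (diag d)"
  have D: "?D \<in> N" "?D \<in> carrier SA" using SL det by (auto simp: SL_def linear_in_SA)
  have monomial: "shear i (Poly_Mapping.single m c) \<in> N" if m: "i \<notin> Poly_Mapping.keys m" for m c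
  proof -
    \<comment> \<open>Substituting \<open>?D\<close> contributes one factor \<open>1 / 2\<close> for
      each power of the variable \<open>j\<close>; the entry \<open>2\<close> at \<open>i\<close>
      contributes one more, so the exponent is positive even if \<open>j\<close> does not
      occur.\<close>
    define e :: 'k where "e = (1 / 2) ^ Suc (Poly_Mapping.lookup m j)"
    have "e \<noteq> 1"
    proof
      assume "e = 1"
      then have "(2 :: 'k) ^ Suc (Poly_Mapping.lookup m j) = 1" by (simp add: e_def power_one_over)
      then have "of_nat (2 ^ Suc (Poly_Mapping.lookup m j)) = (of_nat 1 :: 'k)" by simp
      then have "2 ^ Suc (Poly_Mapping.lookup m j) = (1 :: nat)" by (simp only: of_nat_eq_iff)
      then show False by simp
    qed
    \<comment> \<open>The commutator of the shear by \<open>q\<close> with \<open>?D\<close> will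
      have coefficient \<open>(e - 1) * c' = c\<close>.\<close>
    define c' where "c' = c / (e - 1)"
    define q where "q = Poly_Mapping.single m c'"
    have vars: "i \<notin> mpoly_vars (Poly_Mapping.single m b)" for b :: 'k
      using m by (auto simp: mpoly_vars_def split: if_splits)
    have "(\<Prod>k\<in>UNIV. d k ^ Poly_Mapping.lookup m k) = (1 / 2) ^ Poly_Mapping.lookup m j"
    proof -
      have "(\<Prod>k\<in>UNIV. d k ^ Poly_Mapping.lookup m k) =
          (\<Prod>k\<in>UNIV. if k = j then (1 / 2) ^ Poly_Mapping.lookup m j else 1)"
        using m ji by (intro prod.cong) (auto simp: d_def in_keys_iff)
      then show ?thesis by simp
    qed
    moreover have "mpoly_subst ?D q = mconst (\<Prod>k\<in>UNIV. d k ^ Poly_Mapping.lookup m k) * q"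
      unfolding q_def mpoly_subst_single linear_diag_apply power_mult_distrib prod.distrib
      unfolding monomial_eq[of m c']
      by (simp add: mconst_prod mconst_power ac_simps)
    ultimately have "mpoly_subst ?D q = Poly_Mapping.single m ((1 / 2) ^ Poly_Mapping.lookup m j * c')"
      by (simp add: q_def mconst_def mult_single)
    also have "(1 / 2) ^ Poly_Mapping.lookup m j * c' = 2 * (e * c')" by (simp add: e_def)
    also have "Poly_Mapping.single m (2 * (e * c')) = mconst 2 * Poly_Mapping.single m (e * c')"
      by (simp only: mconst_def mult_single add_0)
    finally have Dq: "mpoly_subst ?D q = mconst 2 * Poly_Mapping.single m (e * c')" .
    let ?S = "shear i q" and ?S' = "shear i (Poly_Mapping.single m (e * c'))"
    have S: "?S \<in> carrier SA" "?S' \<in> carrier SA" using vars by (simp_all add: q_def shear_in_SA)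
    have "poly_map_comp ?D ?S' = poly_map_comp ?S ?D"
      unfolding shear_comp_poly_map Dq
      by (rule ext) (simp add: poly_map_comp_def linear_diag_apply mpoly_subst_mult shear_def d_def distrib_left)
    then have "conj_by (inv\<^bsub>SA\<^esub> ?D) ?S = ?S'"
      using D S by (intro group_conj_by_eqI(2)[OF group_SA]) (simp_all add: mult_SA)
    then have "?S' \<otimes>\<^bsub>SA\<^esub> inv\<^bsub>SA\<^esub> ?S \<in> N"
      using commutator_mem[of "inv\<^bsub>SA\<^esub> ?D" ?S] D S by simp
    then have "shear i (Poly_Mapping.single m (e * c') - q) \<in> N"
      using vars by (simp add: q_def inv_shear mult_SA shear_comp)
    moreover have "(e - 1) * c' = c" using \<open>e \<noteq> 1\<close> by (simp add: c'_def)
    then have "e * c' - c' = c" by (simp add: left_diff_distrib)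
    ultimately show ?thesis by (simp add: q_def flip: single_diff)
  qed
  have "i \<notin> mpoly_vars (\<Sum>m\<in>M. Poly_Mapping.single m (f m)) \<and> shear i (\<Sum>m\<in>M. Poly_Mapping.single m (f m)) \<in> N"
    if "\<And>m. m \<in> M \<Longrightarrow> i \<notin> Poly_Mapping.keys m" "finite M" for M and f :: "('n \<Rightarrow>\<^sub>0 nat) \<Rightarrow> 'k"
    using that(2,1)
  proof (induction M rule: finite_induct)
    case empty
    then show ?case using subgroup.one_closed[OF NS] by (simp add: one_SA)
  next
    case (insert m M)
    let ?q = "\<Sum>m\<in>M. Poly_Mapping.single m (f m)"
    have m: "i \<notin> mpoly_vars (Poly_Mapping.single m (f m))"
      using insert.prems by (auto simp: mpoly_vars_def split: if_splits)
    have "shear i (Poly_Mapping.single m (f m)) \<otimes>\<^bsub>SA\<^esub> shear i ?q \<in> N"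
      using insert by (intro subgroup.m_closed[OF NS] monomial) auto
    moreover have "i \<notin> mpoly_vars (Poly_Mapping.single m (f m) + ?q)"
      using mpoly_vars_add[of "Poly_Mapping.single m (f m)" ?q] m insert by auto
    ultimately show ?case using insert.hyps m by (simp add: mult_SA shear_comp)
  qed
  from this[of "Poly_Mapping.keys p" "Poly_Mapping.lookup p"] p show ?thesis
    by (auto simp: mpoly_vars_def simp flip: mpoly_sum_monomials)
qed

text \<open>Components are made trivial from the smallest variable upwards. For the next variable
  \<open>m\<close>, the polynomial \<open>\<sigma> m - mvar m\<close> involves only variables whose
  components are already trivial, so one shear on the left removes it without affecting the other
  components.\<close>

lemma normal_SL_imp_unitri:
  fixes N :: "('n::{finite, linorder}, 'k::field_char_0) poly_map set"
  assumes card: "CARD('n) \<ge> 2" and N: "N \<lhd> SA" and SL: "SL \<subseteq> N"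
  shows "unitri \<subseteq> N"
proof -
  interpret normal N SA by fact
  have NS: "subgroup N SA" by (rule subgroup_axioms)
  have "\<sigma> \<in> N" if "\<forall>i\<in>J. {..<i} \<subseteq> J" "\<sigma> \<in> unitri" "\<And>i. i \<in> J \<Longrightarrow> \<sigma> i = mvar i" for \<sigma> and J :: "'n set"
    using that
  proof (induction "card (- J)" arbitrary: J \<sigma> rule: less_induct)
    case less
    show ?case
    proof (cases "J = UNIV")
      case True
      then have "\<sigma> = mvar" using less.prems by auto
      then show ?thesis using subgroup.one_closed[OF NS] by (simp add: one_SA)
    next
      case False
      obtain m where m: "m \<notin> J" "{..<m} \<subseteq> J" and down: "\<forall>i\<in>insert m J. {..<i} \<subseteq> insert m J"
        and card_less: "card (- insert m J) < card (- J)"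
        by (rule downward_closed_extend[OF less.prems(1) False])
      define p where "p = \<sigma> m - mvar m"
      have p: "mpoly_vars p \<subseteq> {..<m}" unfolding p_def by (rule unitriD[OF less.prems(2)])
      then have mp: "m \<notin> mpoly_vars p" by auto
      define \<tau> where "\<tau> = shear m (- p) \<otimes>\<^bsub>SA\<^esub> \<sigma>"
      have "mpoly_subst \<sigma> p = mpoly_subst mvar p"
        using p m less.prems(3) by (intro mpoly_subst_cong) auto
      then have \<tau>_apply: "\<tau> k = (if k = m then mvar m else \<sigma> k)" for k
        by (simp add: \<tau>_def mult_SA shear_comp_poly_map mpoly_subst_uminus) (simp add: p_def)
      have "\<tau> \<in> N"
      proof (rule less.hyps[OF card_less down])
        show "\<tau> \<in> unitri"
          unfolding \<tau>_def using p less.prems(2)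
          by (intro subgroup.m_closed[OF subgroup_unitri] shear_in_unitri) auto
      qed (use less.prems(3) in \<open>auto simp: \<tau>_apply\<close>)
      then have "shear m p \<otimes>\<^bsub>SA\<^esub> \<tau> \<in> N"
        using normal_SL_imp_shear[OF card N SL mp] by (intro subgroup.m_closed[OF NS])
      moreover have "shear m p \<otimes>\<^bsub>SA\<^esub> \<tau> = \<sigma>"
      proof -
        have "\<sigma> \<in> carrier SA" using less.prems(2) unitri_subset_SA by blast
        moreover have "shear m p \<otimes>\<^bsub>SA\<^esub> shear m (- p) = \<one>\<^bsub>SA\<^esub>"
          using mp by (simp add: mult_SA one_SA shear_comp)
        ultimately show ?thesis
          using mp by (simp add: \<tau>_def shear_in_SA m_assoc[symmetric])
      qed
      ultimately show ?thesis by simp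
    qed
  qed
  from this[of "{}"] show ?thesis by blast
qed

section \<open>Normal form of triangular words\<close>

text \<open>The last affine factor is left out, as its determinant need not be \<open>1\<close>.\<close>

fun tri_words :: "nat \<Rightarrow> ('n::{finite, linorder}, 'k::field) poly_map set" where
  "tri_words 0 = {mvar}"
| "tri_words (Suc m) = {X \<otimes>\<^bsub>SA\<^esub> affine_map A v \<otimes>\<^bsub>SA\<^esub> \<tau> | X A v \<tau>. X \<in> tri_words m \<and> det A = 1 \<and> \<tau> \<in> unitri}"

lemma tri_words_subset_SA: "tri_words m \<subseteq> carrier SA"
proof -
  interpret group SA by (rule group_SA)
  show ?thesis
  proof (induction m)
    case 0
    then show ?case using one_closed by (simp add: one_SA)
  next
    case (Suc m)
    then show ?case using unitri_subset_SA by (auto simp: affine_map_in_SA intro!: m_closed)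
  qed
qed

lemma poly_map_comp_assoc:
  "poly_map_comp (poly_map_comp \<phi> \<psi>) \<theta> = poly_map_comp \<phi> (poly_map_comp \<psi> \<theta>)"
  by (simp add: poly_map_comp_def mpoly_subst_subst)

text \<open>The diagonal part passes to the right: with \<open>d i = c i * a i\<close>, multiplying
  on the right by the inverse of \<open>diag d\<close> normalizes the coefficient of
  \<open>mvar i\<close> to \<open>1\<close> and keeps the triangular shape.\<close>

lemma linear_diag_factor_BA:
  fixes \<tau> :: "('n::{finite, linorder}, 'k::field) poly_map"
  assumes \<tau>: "\<tau> \<in> BA" and c: "\<And>i. c i \<noteq> 0"
  obtains \<tau>' d where "\<tau>' \<in> unitri" "\<And>i. d i \<noteq> 0"
    "poly_map_comp (linear_poly_map (diag c)) \<tau> = poly_map_comp \<tau>' (linear_poly_map (diag d))"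
proof -
  interpret GA: group GA by (rule group_GA)
  obtain a P where a: "\<And>i. a i \<noteq> 0" and P: "\<And>i. mpoly_vars (P i) \<subseteq> {..<i}"
    and \<tau>_apply: "\<And>i. \<tau> i = mconst (a i) * mvar i + P i" and "\<tau> \<in> carrier GA"
    using \<tau> unfolding BA_def by blast
  define d where "d i = c i * a i" for i
  have d: "d i \<noteq> 0" for i using a c by (simp add: d_def)
  define e where "e i = inverse (d i)" for i
  have e: "e i \<noteq> 0" for i using d by (simp add: e_def)
  have diag_GA: "linear_poly_map (diag b) \<in> carrier GA" if "\<And>i. b i \<noteq> 0" for b :: "'n \<Rightarrow> 'k"
    using that by (simp add: linear_eq_affine_map affine_map_in_GA det_diag)
  define \<tau>' where "\<tau>' = poly_map_comp (poly_map_comp (linear_poly_map (diag c)) \<tau>) (linear_poly_map (diag e))"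
  have "\<tau>' \<in> carrier GA"
    unfolding \<tau>'_def mult_GA[symmetric] using \<open>\<tau> \<in> carrier GA\<close> c e by (intro GA.m_closed diag_GA)
  moreover have "mpoly_vars (\<tau>' i - mvar i) \<subseteq> {..<i}" for i
  proof -
    have "mconst (c i) * mconst (a i) * mconst (e i) = (1 :: ('n, 'k) mpoly)"
      using a[of i] c[of i] by (simp add: mconst_mult[symmetric] e_def d_def field_simps)
    then have "\<tau>' i = mvar i + mconst (c i) * mpoly_subst (linear_poly_map (diag e)) (P i)"
      by (simp add: \<tau>'_def poly_map_comp_def linear_diag_apply mpoly_subst_mult mpoly_subst_add
          \<tau>_apply distrib_left mult.assoc[symmetric])
    moreover have "mpoly_vars (mpoly_subst (linear_poly_map (diag e)) (P i)) \<subseteq> {..<i}"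
    proof (rule mpoly_vars_subst_lessThan[OF P])
      fix j show "mpoly_vars (linear_poly_map (diag e) j) \<subseteq> {..j}"
        using mpoly_vars_mult[of "mconst (e j)" "mvar j :: ('n, 'k) mpoly"] by (auto simp: linear_diag_apply)
    qed
    ultimately show ?thesis
      using mpoly_vars_mult[of "mconst (c i)" "mpoly_subst (linear_poly_map (diag e)) (P i)"] by auto
  qed
  ultimately have "\<tau>' \<in> unitri" by (simp add: unitri_def)
  moreover have "poly_map_comp (linear_poly_map (diag c)) \<tau> = poly_map_comp \<tau>' (linear_poly_map (diag d))"
  proof -
    have "poly_map_comp (linear_poly_map (diag e)) (linear_poly_map (diag d)) = mvar"
      using d by (simp add: poly_map_comp_linear diag_mult e_def diag_1 linear_poly_map_id)
    then have "poly_map_comp \<tau>' (linear_poly_map (diag d)) = poly_map_comp (poly_map_comp (linear_poly_map (diag c)) \<tau>) mvar"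
      by (simp add: \<tau>'_def poly_map_comp_assoc)
    then show ?thesis by (simp add: poly_map_comp_def)
  qed
  ultimately show ?thesis using that d by blast
qed

text \<open>Each affine factor is split into one of determinant \<open>1\<close> and a diagonal map.
  The latter is passed through the next triangular factor and absorbed into the affine factor after
  it, so that in the end only the last affine factor can have a determinant other than
  \<open>1\<close>.\<close>

lemma m_triangular_normal_form:
  fixes \<phi> :: "('n::{finite, linorder}, 'k::field) poly_map"
  assumes "m_triangular m \<phi>"
  shows "\<exists>X A v. X \<in> tri_words m \<and> det A \<noteq> 0 \<and> \<phi> = poly_map_comp X (affine_map A v)"
  using assms
proof (induction rule: m_triangular.induct)
  case (1 \<alpha>)
  then obtain A v where "\<alpha> = affine_map A v" "det A \<noteq> 0" by (rule Aff_imp_affine_map)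
  then have "mvar \<in> tri_words 0 \<and> det A \<noteq> 0 \<and> \<alpha> = poly_map_comp mvar (affine_map A v)"
    by (simp add: poly_map_comp_def)
  then show ?case by blast
next
  case (2 m \<phi> \<tau> \<alpha>)
  then obtain X A v where X: "X \<in> tri_words m" and A: "det A \<noteq> 0"
    and \<phi>: "\<phi> = poly_map_comp X (affine_map A v)" by blast
  obtain B u where \<alpha>: "\<alpha> = affine_map B u" and B: "det B \<noteq> 0" by (rule Aff_imp_affine_map[OF 2(3)])
  fix i0 :: 'n
  \<comment> \<open>The whole determinant is put into one arbitrary coordinate
    \<open>i0\<close>.\<close>
  define c where "c i = (if i = i0 then det A else 1)" for i
  have c: "c i \<noteq> 0" for i using A by (simp add: c_def)
  define A' where "A' = A ** diag (\<lambda>i. inverse (c i))"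
  have "det A' = det A * (\<Prod>i\<in>UNIV. if i = i0 then inverse (det A) else 1)"
    by (simp add: A'_def det_mul det_diag c_def if_distrib[of inverse] cong: if_cong)
  then have A': "det A' = 1" using A by simp
  have "A' ** diag c = A"
    using c by (simp add: A'_def matrix_mul_assoc[symmetric] diag_mult diag_1)
  then have A_eq: "affine_map A v = poly_map_comp (affine_map A' v) (linear_poly_map (diag c))"
    by (simp add: linear_eq_affine_map affine_map_comp)
  obtain \<tau>' d where \<tau>': "\<tau>' \<in> unitri" and d: "\<And>i. d i \<noteq> 0"
    and eq: "poly_map_comp (linear_poly_map (diag c)) \<tau> = poly_map_comp \<tau>' (linear_poly_map (diag d))"
    using linear_diag_factor_BA[OF 2(2), of c] c by blast
  have "poly_map_comp (linear_poly_map (diag d)) \<alpha> = affine_map (diag d ** B) (diag d *v u)"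
    by (simp add: \<alpha> linear_eq_affine_map affine_map_comp)
  then have "\<phi> \<otimes>\<^bsub>GA\<^esub> \<tau> \<otimes>\<^bsub>GA\<^esub> \<alpha> =
      poly_map_comp (X \<otimes>\<^bsub>SA\<^esub> affine_map A' v \<otimes>\<^bsub>SA\<^esub> \<tau>') (affine_map (diag d ** B) (diag d *v u))"
    unfolding \<phi> A_eq mult_GA mult_SA
    by (metis eq poly_map_comp_assoc)
  moreover have "X \<otimes>\<^bsub>SA\<^esub> affine_map A' v \<otimes>\<^bsub>SA\<^esub> \<tau>' \<in> tri_words (Suc m)"
    using X A' \<tau>' by auto
  moreover have "det (diag d ** B) \<noteq> 0" using B d by (simp add: det_mul det_diag)
  ultimately show ?case by blast
qed

lemma normal_SL_imp_tri_words:
  fixes N :: "('n::{finite, linorder}, 'k::field_char_0) poly_map set"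
  assumes "CARD('n) \<ge> 2" "N \<lhd> SA" "SL \<subseteq> N"
  shows "tri_words m \<subseteq> N"
proof -
  have NS: "subgroup N SA" by (rule normal_imp_subgroup[OF assms(2)])
  show ?thesis
  proof (induction m)
    case 0
    then show ?case using subgroup.one_closed[OF NS] by (simp add: one_SA)
  next
    case (Suc m)
    then show ?case
      using normal_SL_imp_affine[OF assms] normal_SL_imp_unitri[OF assms]
      by (auto intro!: subgroup.m_closed[OF NS])
  qed
qed

section \<open>The two inclusions of the theorem\<close>

lemma normal_closure_minimal: "N \<lhd> G \<Longrightarrow> H \<subseteq> N \<Longrightarrow> normal_closure G H \<subseteq> N"
  by (auto simp: normal_closure_def)

theorem theorem22:
  fixes \<phi> :: "('n::{finite, linorder}, 'k::field_char_0) poly_map"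
  assumes "CARD('n) \<ge> 2"
    and "\<phi> \<in> carrier SA"
    and "m_triangular 4 \<phi>"
    and "\<phi> \<noteq> \<one>\<^bsub>SA\<^esub>"
  shows "normal_closure SA {\<phi>} = SLIN \<and> normally_co_tame \<phi>"
proof -
  obtain X A v where X: "X \<in> tri_words 4" and \<phi>: "\<phi> = poly_map_comp X (affine_map A v)"
    using m_triangular_normal_form[OF assms(3)] by blast
  \<comment> \<open>Since \<open>X\<close> and \<open>\<phi>\<close> have Jacobian determinant
    \<open>1\<close>, so has the last affine factor.\<close>
  have "X \<in> carrier SA" using X tri_words_subset_SA by blast
  then have "det (jacobian X) = 1" by (simp add: SA_def)
  moreover have "det (jacobian \<phi>) = 1" using assms(2) by (simp add: SA_def)
  ultimately have A: "det A = 1"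
    unfolding \<phi> det_jacobian_comp by (simp add: det_jacobian_affine_map)
  have SLIN: "SLIN \<lhd> SA" "SL \<subseteq> (SLIN :: ('n, 'k) poly_map set)"
    unfolding SLIN_def by (rule normal_closure_normal[OF group_SA SL_subset_SA])+
  \<comment> \<open>One inclusion: every factor of the word lies in the normal subgroup
    \<open>SLIN\<close>.\<close>
  have "X \<otimes>\<^bsub>SA\<^esub> affine_map A v \<in> SLIN"
    using normal_SL_imp_tri_words[OF assms(1) SLIN] normal_SL_imp_affine[OF assms(1) SLIN A] X
    by (intro subgroup.m_closed[OF normal_imp_subgroup[OF SLIN(1)]]) auto
  then have le: "normal_closure SA {\<phi>} \<subseteq> SLIN"
    by (intro normal_closure_minimal[OF SLIN(1)]) (simp add: \<phi> mult_SA)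
  \<comment> \<open>For the other inclusion it is enough to find a nontrivial translation in
    \<open>N\<close>.\<close>
  define N where "N = normal_closure SA {\<phi>}"
  have N: "N \<lhd> SA" and "\<phi> \<in> N"
    using normal_closure_normal[OF group_SA, of "{\<phi>}"] assms(2) by (auto simp: N_def)
  have "\<exists>v. transl v \<in> N \<and> v \<noteq> 0"
  proof (rule ccontr)
    assume no_transl: "\<not> ?thesis"
    define z :: "('n, 'k) poly_map" where "z = transl (axis (Max UNIV) 1)"
    interpret rigid_normal N SA unitri "range transl" z
    proof (rule rigid_normal.intro[OF N], rule rigid_normal_axioms.intro)
      show "subgroup unitri SA" by (rule subgroup_unitri)
      show "range transl \<subseteq> unitri" using transl_in_unitri by blast
      show "z \<in> range transl" by (simp add: z_def)
      show "z \<noteq> \<one>\<^bsub>SA\<^esub>" by (simp add: z_def one_SA)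
    next
      fix \<sigma> :: "('n, 'k) poly_map" assume \<sigma>: "\<sigma> \<in> unitri"
      \<comment> \<open>\<open>z\<close> moves only the largest variable, which occurs in no
        \<open>\<sigma> i - mvar i\<close>.\<close>
      have "mpoly_subst z (\<sigma> i - mvar i) = mpoly_subst mvar (\<sigma> i - mvar i)" for i
      proof (rule mpoly_subst_cong)
        fix j assume "j \<in> mpoly_vars (\<sigma> i - mvar i)"
        then have "j < i" using unitriD[OF \<sigma>] by auto
        then have "j \<noteq> Max UNIV" using Max_ge[of UNIV i] by auto
        then show "z j = mvar j" by (simp add: z_def transl_apply axis_def)
      qed
      then have "mpoly_subst z (\<sigma> i) = \<sigma> i + mconst (axis (Max UNIV) 1 $ i)" for i
        by (simp add: mpoly_subst_diff) (simp add: z_def transl_apply algebra_simps)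
      then show "\<sigma> \<otimes>\<^bsub>SA\<^esub> z = z \<otimes>\<^bsub>SA\<^esub> \<sigma>"
        by (simp add: mult_SA fun_eq_iff z_def transl_comp_apply) (simp add: poly_map_comp_def)
    next
      fix s t :: "('n, 'k) poly_map" assume "s \<in> unitri" "t \<in> range transl"
      then show "\<exists>k. ((\<lambda>s. inv\<^bsub>SA\<^esub> s \<otimes>\<^bsub>SA\<^esub> inv\<^bsub>SA\<^esub> t \<otimes>\<^bsub>SA\<^esub> s \<otimes>\<^bsub>SA\<^esub> t) ^^ k) s = \<one>\<^bsub>SA\<^esub>"
        using unitri_nilpotent by blast
    next
      fix Y t :: "('n, 'k) poly_map"
      assume "Y \<in> N" "t \<in> range transl" "t \<noteq> \<one>\<^bsub>SA\<^esub>" "group.conj_by SA Y t \<in> range transl"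
      then show "Y = \<one>\<^bsub>SA\<^esub>"
        using normal_rigid[OF assms(1) N, of Y] no_transl by (auto simp: one_SA)
    qed
    have conj_by_z: "conj_by (affine_map B w) z \<in> range transl" if "det B = 1" for B and w :: "('k, 'n) vec"
      using conj_by_affine_transl[OF that] by (simp add: z_def)
    have "X \<in> tri_words (Suc (Suc (Suc (Suc 0))))" using X by (simp add: eval_nat_numeral)
    then obtain A0 v0 u1 A1 v1 u2 A2 v2 u3 A3 v3 u4 where
      u: "u1 \<in> unitri" "u2 \<in> unitri" "u3 \<in> unitri" "u4 \<in> unitri" and
      dets: "det A0 = 1" "det A1 = 1" "det A2 = 1" "det A3 = 1" and
      X_eq: "X = mvar \<otimes>\<^bsub>SA\<^esub> affine_map A0 v0 \<otimes>\<^bsub>SA\<^esub> u1 \<otimes>\<^bsub>SA\<^esub> affine_map A1 v1 \<otimes>\<^bsub>SA\<^esub> u2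
        \<otimes>\<^bsub>SA\<^esub> affine_map A2 v2 \<otimes>\<^bsub>SA\<^esub> u3 \<otimes>\<^bsub>SA\<^esub> affine_map A3 v3 \<otimes>\<^bsub>SA\<^esub> u4"
      unfolding tri_words.simps by blast
    define a0 where "a0 = affine_map A0 v0"
    define a1 where "a1 = affine_map A1 v1"
    define a2 where "a2 = affine_map A2 v2"
    define a3 where "a3 = affine_map A3 v3"
    \<comment> \<open>Conjugation carries the leading affine factor \<open>a0\<close> to the end, so
      that the word begins with a triangular factor as \<open>four_triangular_trivial\<close>
      requires.\<close>
    define a4 where "a4 = affine_map A v \<otimes>\<^bsub>SA\<^esub> a0"
    have a4: "a4 = affine_map (A ** A0) (A *v v0 + v)"
      by (simp add: a4_def a0_def mult_SA affine_map_comp)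
    have [simp]: "a0 \<in> carrier SA" "a1 \<in> carrier SA" "a2 \<in> carrier SA" "a3 \<in> carrier SA"
      "a4 \<in> carrier SA" "affine_map A v \<in> carrier SA"
      using dets A by (simp_all add: a0_def a1_def a2_def a3_def a4 affine_map_in_SA det_mul)
    have [simp]: "u1 \<in> carrier SA" "u2 \<in> carrier SA" "u3 \<in> carrier SA" "u4 \<in> carrier SA"
      using u by (simp_all add: U_closed)
    let ?W = "u1 \<otimes>\<^bsub>SA\<^esub> a1 \<otimes>\<^bsub>SA\<^esub> u2 \<otimes>\<^bsub>SA\<^esub> a2 \<otimes>\<^bsub>SA\<^esub> u3 \<otimes>\<^bsub>SA\<^esub> a3 \<otimes>\<^bsub>SA\<^esub> u4 \<otimes>\<^bsub>SA\<^esub> a4"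
    have "\<phi> = a0 \<otimes>\<^bsub>SA\<^esub> (u1 \<otimes>\<^bsub>SA\<^esub> a1 \<otimes>\<^bsub>SA\<^esub> u2 \<otimes>\<^bsub>SA\<^esub> a2 \<otimes>\<^bsub>SA\<^esub> u3 \<otimes>\<^bsub>SA\<^esub> a3 \<otimes>\<^bsub>SA\<^esub> u4 \<otimes>\<^bsub>SA\<^esub> affine_map A v)"
      using l_one[of a0] unfolding \<phi> mult_SA[symmetric] X_eq a0_def[symmetric] a1_def[symmetric]
        a2_def[symmetric] a3_def[symmetric] by (simp add: one_SA m_assoc)
    then have W: "conj_by a0 ?W = \<phi>"
      by (simp add: conj_by_def a4_def m_assoc)
    then have "?W \<in> N" using \<open>\<phi> \<in> N\<close> conj_by_mem_iff[of a0 ?W] by simp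
    moreover have "conj_by (inv\<^bsub>SA\<^esub> a4) z \<in> range transl"
    proof -
      \<comment> \<open>\<open>B\<close> inverts the linear part of \<open>a4\<close>, so
        \<open>a4\<close> conjugates the translation by \<open>B *v axis (Max UNIV) 1\<close> to
        \<open>z\<close>.\<close>
      obtain B where B: "(A ** A0) ** B = mat 1"
        using A dets invertible_det_nz[of "A ** A0"] by (auto simp: invertible_def det_mul)
      have "conj_by a4 (transl (B *v axis (Max UNIV) 1)) = z"
        unfolding a4 using A dets B
        by (subst conj_by_affine_transl) (simp_all add: det_mul z_def matrix_vector_mul_assoc)
      then have "conj_by (inv\<^bsub>SA\<^esub> a4) z = transl (B *v axis (Max UNIV) 1)"
        by (metis \<open>a4 \<in> carrier SA\<close> conj_by_inv_conj_by(1) transl_in_SA)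
      then show ?thesis by simp
    qed
    ultimately have "?W = \<one>\<^bsub>SA\<^esub>"
      using u dets conj_by_z by (intro four_triangular_trivial) (simp_all add: a1_def a2_def a3_def affine_map_in_SA)
    then show False using W assms(4) by simp
  qed
  then have "SL \<subseteq> N"
    using normal_transl_all[OF assms(1) N] by (intro normal_transl_imp_SL[OF N]) blast
  then have "SLIN \<subseteq> N" unfolding SLIN_def by (rule normal_closure_minimal[OF N])
  then show ?thesis using le assms(2) by (auto simp: N_def normally_co_tame_def)
qed

end
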